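(* There is a deterministic algorithm that, for all positive integers $n,m$, every $\epsilon>0$ and every matrix $A\in\mathbb{R}^{m\times n}$ whose rows satisfy $\|A_{i,:}\|_2\le 1$ for all $i\in[m]$ (where $n,m,\epsilon$ are given to the algorithm and $A$ is accessible only via matvec queries), computes an $\epsilon$-solution of the $\ell_2$-$\ell_1$ game with payoff matrix $A$, i.e., a pair $(\hat x,\hat y)\in\mathbb{B}^n\times\Delta^m$ with $\max_{y\in\Delta^m}y^\top A\hat x-\min_{x\in\mathbb{B}^n}\hat y^\top Ax\le\epsilon$, using $\tilde O(\epsilon^{-2/3})$ matvecs to $A$.
   Context: $\Delta^k=\{u\in\mathbb{R}^k_{\ge0}:\|u\|_1=1\}$ and $\mathbb{B}^k=\{u\in\mathbb{R}^k:\|u\|_2\le1\}$. A matvec (query) to $A$ takes an input $(x,y)\in\mathbb{B}^n\times\Delta^m$ and returns $(A^\top y,Ax)$. The algorithm may choose its queries adaptively (each query is a deterministic function of $n,m,\epsilon$ and the previous answers); only the number of matvec queries is counted. $\tilde O(\cdot)$ hides multiplicative polylogarithmic factors in $n$, $m$ and $\epsilon^{-1}$: the number of queries is at most $\epsilon^{-2/3}$ times an absolute constant times a fixed (absolute) power of a logarithm of $n$, $m$, $\epsilon^{-1}$ (e.g. of $\log(2+n+m+\epsilon^{-1})$). *)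

theory Defs
  imports Complex_Main "Jordan_Normal_Form.Matrix"
begin

definition l1_norm :: "real vec \<Rightarrow> real" where
  "l1_norm v = (\<Sum>i<dim_vec v. \<bar>v $ i\<bar>)"

definition l2_norm :: "real vec \<Rightarrow> real" where
  "l2_norm v = sqrt (v \<bullet> v)"

definition prob_simplex :: "nat \<Rightarrow> real vec set" where
  "prob_simplex k = {u \<in> carrier_vec k. (\<forall>i<k. 0 \<le> u $ i) \<and> l1_norm u = 1}"

definition unit_ball :: "nat \<Rightarrow> real vec set" where
  "unit_ball k = {u \<in> carrier_vec k. l2_norm u \<le> 1}"

(* Here n = dim_col A and m = dim_row A.  For n, m > 0 both feasible sets are nonempty and
   compact and the objectives are linear, so SUP and INF are the maximum and the minimum. *)
definition duality_gap :: "real mat \<Rightarrow> real vec \<Rightarrow> real vec \<Rightarrow> real" where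
  "duality_gap A x' y' =
     (SUP y\<in>prob_simplex (dim_row A). y \<bullet> (A *\<^sub>v x')) -
     (INF x\<in>unit_ball (dim_col A). y' \<bullet> (A *\<^sub>v x))"

definition eps_solution :: "real mat \<Rightarrow> real \<Rightarrow> real vec \<Rightarrow> real vec \<Rightarrow> bool" where
  "eps_solution A \<epsilon> x' y' \<longleftrightarrow>
     x' \<in> unit_ball (dim_col A) \<and> y' \<in> prob_simplex (dim_row A) \<and> duality_gap A x' y' \<le> \<epsilon>"

type_synonym answer = "real vec \<times> real vec"

definition matvec :: "real mat \<Rightarrow> real vec \<Rightarrow> real vec \<Rightarrow> answer" where
  "matvec A x y = (transpose_mat A *\<^sub>v y, A *\<^sub>v x)"

datatype action = Query "real vec" "real vec" | Output "real vec" "real vec"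

(* A deterministic algorithm maps n, m, eps and the answers received so far (oldest first)
   to its next action.  Only queries are counted, so no computability is imposed. *)
type_synonym matvec_algorithm = "nat \<Rightarrow> nat \<Rightarrow> real \<Rightarrow> answer list \<Rightarrow> action"

(* run S A h x y N: started after the answers h, the strategy S on the hidden matrix A makes
   exactly N further queries, all admissible, and then halts with output (x, y).
   An inadmissible query blocks the run. *)
inductive run :: "(answer list \<Rightarrow> action) \<Rightarrow> real mat \<Rightarrow>
    answer list \<Rightarrow> real vec \<Rightarrow> real vec \<Rightarrow> nat \<Rightarrow> bool"
  for S :: "answer list \<Rightarrow> action" and A :: "real mat" where
  halt: "S h = Output x y \<Longrightarrow> run S A h x y 0"
| query: "\<lbrakk>S h = Query u v; u \<in> unit_ball (dim_col A); v \<in> prob_simplex (dim_row A);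
           run S A (h @ [matvec A u v]) x y N\<rbrakk>
          \<Longrightarrow> run S A h x y (Suc N)"

end

theory Submission
  imports "HOL-Analysis.Function_Topology" "HOL-Analysis.L2_Norm" Defs
begin

text \<open>
  The run is a mirror-prox scheme with Euclidean divergence on the ball and KL divergence on the
  simplex.  Step \<open>s\<close> is regularized not only towards the previous iterate but towards all
  \<open>z (s - 2 ^ j)\<close> with \<open>2 ^ j\<close> dividing \<open>s\<close>.  On every dyadic level the regret telescopes, which costs
  only a logarithmic factor and bounds the sum of the squared movements on each level separately.
  Chaining along binary expansions then gives \<open>\<Sum>i. max s. y s i\<close> polylogarithmic, although the
  path itself may be long.

  Each step uses the exact solution of the game for the currently learned part \<open>A P\<close> of the matrix, \<open>P\<close>
  the orthogonal projection to the learned directions, and the linearization of the rest.  With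
  \<open>\<beta> = \<epsilon> powr (1/3)\<close> and step size at most \<open>1 / \<beta>\<close>, capped so that the step moves at most \<open>\<beta> / 8\<close>, either
  the mirror-prox inequality holds, or the answers reveal a unit direction \<open>u\<close> orthogonal to the learned
  ones with \<open>\<Sum>i. y i * (A u i)\<^sup>2 \<ge> \<beta>\<^sup>2 / 64\<close> for the current center \<open>y\<close>.  By Bessel's inequality and the bound
  on \<open>\<Sum>i. max s. y s i\<close> there are \<open>\<beta> powr (-2)\<close> such failures up to logarithms.  Capped steps are equally rare
  as each uses up movement, so \<open>\<beta> / \<epsilon> = \<beta> powr (-2)\<close> full steps, up to logarithms, bring the average regret
  below \<open>\<epsilon>\<close>.
\<close>

section \<open>Elementary real inequalities\<close>

lemma exp_le_quadratic:
  fixes x :: real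
  assumes "x \<le> 1"
  shows "exp x \<le> 1 + x + x\<^sup>2"
proof (cases "0 \<le> x")
  case True
  then show ?thesis using exp_bound assms by blast
next
  case False
  have p: "0 < 1 - x" using False by simp
  \<comment> \<open>For negative \<open>x\<close>, multiplying by \<open>1 - x\<close> turns the
    right side into \<open>1 - x ^ 3\<close>, which is at least 1, while
    \<open>exp x * (1 - x)\<close> is at most 1.\<close>
  have "x ^ 3 \<le> 0" using False by (simp add: power_le_zero_eq)
  then have "1 \<le> (1 + x + x\<^sup>2) * (1 - x)"
    by (simp add: algebra_simps power2_eq_square power3_eq_cube)
  moreover have "exp x * (1 - x) \<le> 1"
    using exp_ge_add_one_self[of "-x"] mult_left_mono[of "1 - x" "exp (-x)" "exp x"]
    by (simp add: exp_minus)
  ultimately show ?thesis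
    using p mult_right_le_imp_le order_trans by blast
qed

text \<open>First-order optimality: near a minimizer the growth along a segment is nonnegative and
  at most \<open>t * a + t\<^sup>2 * k\<close>, so the slope \<open>a\<close> cannot be
  negative.\<close>

lemma nonneg_of_small_perturbation:
  fixes a k t0 :: real
  assumes "0 < t0" and "\<And>t. 0 < t \<Longrightarrow> t \<le> t0 \<Longrightarrow> 0 \<le> t * a + t\<^sup>2 * k"
  shows "0 \<le> a"
proof (rule ccontr)
  assume "\<not> 0 \<le> a"
  define t where "t = min t0 (-a / (2 * (\<bar>k\<bar> + 1)))"
  have "0 < -a / (2 * (\<bar>k\<bar> + 1))" using \<open>\<not> 0 \<le> a\<close> by (intro divide_pos_pos) auto
  then have t: "0 < t" "t \<le> t0" "t \<le> -a / (2 * (\<bar>k\<bar> + 1))"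
    using assms(1) by (auto simp: t_def)
  have "t * (2 * (\<bar>k\<bar> + 1)) \<le> - a"
    using t(3) pos_le_divide_eq[of "2 * (\<bar>k\<bar> + 1)" t "-a"] by simp
  then have "2 * (t * \<bar>k\<bar>) + 2 * t \<le> - a" by (simp only: distrib_left mult.left_commute mult_1_right)
  moreover have "t * k \<le> t * \<bar>k\<bar>" "0 \<le> t * \<bar>k\<bar>" using t(1) by (auto intro: mult_left_mono)
  ultimately have "t * k < - a" using t(1) by linarith
  then have "t * (a + t * k) < 0" using t(1) by (simp add: mult_pos_neg)
  then show False using assms(2)[OF t(1,2)] by (simp add: algebra_simps power2_eq_square)
qed

lemma sum_mult_le_L2_set:
  fixes f g :: "'a \<Rightarrow> real"
  shows "(\<Sum>i\<in>S. f i * g i) \<le> L2_set f S * L2_set g S"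
proof -
  have "(\<Sum>i\<in>S. f i * g i) \<le> (\<Sum>i\<in>S. \<bar>f i\<bar> * \<bar>g i\<bar>)"
    by (intro sum_mono) (metis abs_ge_self abs_mult)
  then show ?thesis using L2_set_mult_ineq order_trans by blast
qed

section \<open>Proximal steps on the product of the ball and the simplex\<close>

text \<open>Vectors are functions on the naturals of which only the first \<open>n\<close> or
  \<open>m\<close> values count. Ball and simplex leave the tail free; the compactness argument pins
  it to 0.\<close>

locale simplex_ball =
  fixes n m :: nat
  assumes m_pos: "0 < m"
begin

definition sqn :: "(nat \<Rightarrow> real) \<Rightarrow> real" where
  "sqn x = (\<Sum>j<n. (x j)\<^sup>2)"

definition bal :: "(nat \<Rightarrow> real) set" where
  "bal = {x. sqn x \<le> 1}"

definition splx :: "(nat \<Rightarrow> real) set" where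
  "splx = {y. (\<forall>i<m. 0 \<le> y i) \<and> (\<Sum>i<m. y i) = 1}"

text \<open>The relative interior of the simplex. Centers and iterates stay here, so that their
  logarithms are meaningful; comparators range over the closed simplex.\<close>

definition isplx :: "(nat \<Rightarrow> real) set" where
  "isplx = {y. (\<forall>i<m. 0 < y i) \<and> (\<Sum>i<m. y i) = 1}"

definition KL :: "(nat \<Rightarrow> real) \<Rightarrow> (nat \<Rightarrow> real) \<Rightarrow> real" where
  "KL u b = (\<Sum>i<m. u i * (ln (u i) - ln (b i)))"

text \<open>Squared Hellinger distance without the factor 1/2: the squared Euclidean distance in
  square-root coordinates.\<close>

definition he :: "(nat \<Rightarrow> real) \<Rightarrow> (nat \<Rightarrow> real) \<Rightarrow> real" where
  "he u b = (\<Sum>i<m. (sqrt (u i) - sqrt (b i))\<^sup>2)"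

definition V :: "(nat \<Rightarrow> real) \<times> (nat \<Rightarrow> real) \<Rightarrow> (nat \<Rightarrow> real) \<times> (nat \<Rightarrow> real) \<Rightarrow> real" where
  "V b u = sqn (\<lambda>j. fst u j - fst b j) / 2 + KL (snd u) (snd b)"

text \<open>The second block carries a minus sign because the simplex player maximizes.\<close>

definition lin :: "(nat \<Rightarrow> real) \<Rightarrow> (nat \<Rightarrow> real) \<Rightarrow>
    (nat \<Rightarrow> real) \<times> (nat \<Rightarrow> real) \<Rightarrow> (nat \<Rightarrow> real) \<times> (nat \<Rightarrow> real) \<Rightarrow> real" where
  "lin gx gy z u = (\<Sum>j<n. gx j * (fst z j - fst u j)) - (\<Sum>i<m. gy i * (snd z i - snd u i))"

text \<open>The three-point inequality satisfied by a Bregman proximal point is taken as the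
  definition, so that only existence needs an optimality argument.\<close>

definition prox :: "(nat \<Rightarrow> real) \<Rightarrow> (nat \<Rightarrow> real) \<Rightarrow>
    (nat \<Rightarrow> real) \<times> (nat \<Rightarrow> real) \<Rightarrow> (nat \<Rightarrow> real) \<times> (nat \<Rightarrow> real) \<Rightarrow> bool" where
  "prox gx gy b z \<longleftrightarrow> z \<in> bal \<times> isplx \<and>
     (\<forall>u \<in> bal \<times> splx. lin gx gy z u \<le> V b u - V z u - V b z)"

lemma isplx_subset: "isplx \<subseteq> splx"
  by (auto simp: isplx_def splx_def less_imp_le)

lemma sqn_nonneg [simp]: "0 \<le> sqn x"
  by (simp add: sqn_def sum_nonneg)

lemma he_nonneg [simp]: "0 \<le> he u b"
  by (simp add: he_def sum_nonneg)

lemma he_sym: "he u b = he b u"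
  by (simp add: he_def power2_commute)

text \<open>Termwise, \<open>ln r \<le> r - 1\<close> at \<open>r = sqrt (b i) / sqrt (u i)\<close>
  bounds the KL term below by \<open>2 * u i - 2 * sqrt (u i) * sqrt (b i)\<close>. Since both
  masses are 1, these bounds add up to the Hellinger distance.\<close>

lemma he_le_KL:
  assumes u: "u \<in> splx" and b: "b \<in> isplx"
  shows "he u b \<le> KL u b"
proof -
  have "2 * u i - 2 * sqrt (u i) * sqrt (b i) \<le> u i * (ln (u i) - ln (b i))" if "i < m" for i
  proof (cases "u i = 0")
    case True
    then show ?thesis by simp
  next
    case False
    have ui: "0 < u i" and bi: "0 < b i"
      using u b that False by (auto simp: splx_def isplx_def order_less_le)
    have "ln (b i / u i) = 2 * ln (sqrt (b i) / sqrt (u i))"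
      using ui bi by (simp add: ln_div ln_sqrt)
    also have "\<dots> \<le> 2 * (sqrt (b i) / sqrt (u i) - 1)"
      using ln_le_minus_one[of "sqrt (b i) / sqrt (u i)"] ui bi by simp
    finally have "u i * (2 - 2 * (sqrt (b i) / sqrt (u i))) \<le> u i * (ln (u i) - ln (b i))"
      using ui bi by (intro mult_left_mono) (auto simp: ln_div)
    moreover have "u i * (sqrt (b i) / sqrt (u i)) = sqrt (u i) * sqrt (b i)"
      using ui by (simp add: field_simps)
    ultimately show ?thesis by (simp add: right_diff_distrib mult.left_commute)
  qed
  then have "(\<Sum>i<m. 2 * u i - 2 * sqrt (u i) * sqrt (b i)) \<le> KL u b"
    unfolding KL_def by (intro sum_mono) auto
  moreover have "(\<Sum>i<m. 2 * u i - 2 * sqrt (u i) * sqrt (b i))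
      = (\<Sum>i<m. (sqrt (u i) - sqrt (b i))\<^sup>2 + (u i - b i))"
    using u b by (intro sum.cong) (auto simp: power2_diff splx_def isplx_def less_imp_le)
  moreover have "\<dots> = he u b + (\<Sum>i<m. u i) - (\<Sum>i<m. b i)"
    by (simp add: he_def sum.distrib sum_subtractf)
  moreover have "(\<Sum>i<m. u i) = 1" "(\<Sum>i<m. b i) = 1"
    using u b by (auto simp: splx_def isplx_def)
  ultimately show ?thesis by simp
qed

lemma V_ge:
  assumes "u \<in> bal \<times> splx" and "b \<in> bal \<times> isplx"
  shows "sqn (\<lambda>j. fst u j - fst b j) / 2 + he (snd u) (snd b) \<le> V b u"
  using assms he_le_KL by (auto simp: V_def)

lemma V_nonneg:
  assumes "u \<in> bal \<times> splx" and "b \<in> bal \<times> isplx"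
  shows "0 \<le> V b u"
  using V_ge[OF assms] by (smt (verit) he_nonneg sqn_nonneg divide_nonneg_nonneg)

lemma bal_convex:
  assumes "x \<in> bal" "u \<in> bal" "0 \<le> t" "t \<le> 1"
  shows "(\<lambda>j. x j + t * (u j - x j)) \<in> bal"
proof -
  have "(x j + t * (u j - x j))\<^sup>2 \<le> (1 - t) * (x j)\<^sup>2 + t * (u j)\<^sup>2" for j
  proof -
    have "(1 - t) * (x j)\<^sup>2 + t * (u j)\<^sup>2 - (x j + t * (u j - x j))\<^sup>2
        = t * (1 - t) * (u j - x j)\<^sup>2"
      by (simp add: algebra_simps power2_eq_square)
    then show ?thesis using assms by (smt (verit) mult_nonneg_nonneg zero_le_power2)
  qed
  then have "sqn (\<lambda>j. x j + t * (u j - x j)) \<le> (1 - t) * sqn x + t * sqn u"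
    unfolding sqn_def sum_distrib_left sum.distrib[symmetric] by (intro sum_mono)
  also have "\<dots> \<le> (1 - t) * 1 + t * 1"
    using assms by (intro add_mono mult_left_mono) (auto simp: bal_def)
  finally show ?thesis by (simp add: bal_def)
qed

text \<open>With the tail pinned to 0 the ball is a closed subset of a product of compact
  sets.\<close>

lemma compact_bal: "compact {x \<in> bal. \<forall>j\<ge>n. x j = 0}"
proof -
  define S where "S j = (if j < n then {-1..1::real} else {0})" for j
  have "compactin (product_topology (\<lambda>_. euclidean) UNIV) (PiE UNIV S)"
    unfolding compactin_PiE by (auto simp: S_def)
  then have c: "compact (PiE UNIV S)"
    by (simp add: euclidean_product_topology)
  have cl: "closed {x :: nat \<Rightarrow> real. sqn x \<le> 1}"
    unfolding sqn_def by (intro closed_Collect_le continuous_intros) auto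
  have "{x \<in> bal. \<forall>j\<ge>n. x j = 0} = {x. sqn x \<le> 1} \<inter> PiE UNIV S"
  proof (intro equalityI subsetI)
    fix x assume x: "x \<in> {x \<in> bal. \<forall>j\<ge>n. x j = 0}"
    have "x j \<in> {-1..1}" if "j < n" for j
    proof -
      have "(x j)\<^sup>2 \<le> sqn x" unfolding sqn_def using that by (intro member_le_sum) auto
      then have "(x j)\<^sup>2 \<le> 1" using x by (simp add: bal_def)
      then have "\<bar>x j\<bar> \<le> 1" by (simp add: abs_square_le_1)
      then show ?thesis by auto
    qed
    then show "x \<in> {x. sqn x \<le> 1} \<inter> PiE UNIV S"
      using x by (auto simp: bal_def S_def)
  next
    fix x assume x: "x \<in> {x. sqn x \<le> 1} \<inter> PiE UNIV S"
    then have "x j \<in> S j" for j by (auto simp: PiE_def)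
    then show "x \<in> {x \<in> bal. \<forall>j\<ge>n. x j = 0}"
      using x by (auto simp: bal_def S_def split: if_splits) (metis empty_iff insert_iff leD)
  qed
  then show ?thesis using closed_Int_compact[OF cl c] by simp
qed

text \<open>The step is implicit: the gradients are taken at the new point, which is the saddle
  point of a regularized bilinear game. Maximizing over the simplex for fixed \<open>x\<close>
  leaves the log-sum-exp term \<open>ln (Z x)\<close>, so \<open>\<Phi>\<close> is minimized over
  the compact ball and \<open>y\<close> consists of the corresponding Gibbs weights.\<close>

lemma prox_exists:
  fixes M :: "nat \<Rightarrow> nat \<Rightarrow> real"
  assumes b: "b \<in> bal \<times> isplx"
  shows "\<exists>z. prox (\<lambda>j. (\<Sum>i<m. M i j * snd z i) + p j) (\<lambda>i. (\<Sum>j<n. M i j * fst z j) + s i) b z"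
proof -
  define g where "g x i = (\<Sum>j<n. M i j * x j) + s i" for x i
  define Z where "Z x = (\<Sum>i<m. snd b i * exp (g x i))" for x
  define \<Phi> where "\<Phi> x = (\<Sum>j<n. p j * x j) + sqn (\<lambda>j. x j - fst b j) / 2 + ln (Z x)" for x
  have bpos: "0 < snd b i" if "i < m" for i
    using b that by (auto simp: isplx_def)
  have Zpos: "0 < Z x" for x
    unfolding Z_def using m_pos bpos by (intro sum_pos) auto
  define K where "K = {x \<in> bal. \<forall>j\<ge>n. x j = 0}"
  have "(\<lambda>_. 0) \<in> K" by (auto simp: K_def bal_def sqn_def)
  moreover have "continuous_on K \<Phi>"
  proof -
    have coord: "continuous_on K (\<lambda>x. x j)" for j
      by (rule continuous_on_subset[OF continuous_on_product_coordinates]) simp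
    have "continuous_on K Z"
      unfolding Z_def g_def by (intro continuous_intros coord)
    moreover have "\<forall>x\<in>K. Z x \<noteq> 0" using Zpos less_irrefl by metis
    ultimately show ?thesis
      unfolding \<Phi>_def sqn_def by (intro continuous_intros coord) auto
  qed
  ultimately obtain x where x: "x \<in> K" and xmin: "\<And>u. u \<in> K \<Longrightarrow> \<Phi> x \<le> \<Phi> u"
    using continuous_attains_inf[of K \<Phi>] compact_bal unfolding K_def by auto
  define y where "y i = snd b i * exp (g x i) / Z x" for i
  have ypos: "0 < y i" if "i < m" for i
    using bpos[OF that] Zpos by (simp add: y_def)
  have ysum: "(\<Sum>i<m. y i) = 1"
    unfolding y_def using Zpos[of x] by (simp add: Z_def flip: sum_divide_distrib)
  have xb: "x \<in> bal" and yi: "y \<in> isplx"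
    using x ypos ysum by (auto simp: K_def isplx_def)
  have lny: "ln (y i) - ln (snd b i) = g x i - ln (Z x)" if "i < m" for i
    using bpos[OF that] Zpos[of x] by (simp add: y_def ln_div ln_mult)
  \<comment> \<open>For Gibbs weights the log ratios to the center are \<open>g x i\<close> up to a
    constant, so the simplex part holds with equality.\<close>
  have ypart: "- (\<Sum>i<m. g x i * (y i - u i)) = KL u (snd b) - KL u y - KL y (snd b)"
    if "u \<in> splx" for u
  proof -
    have "KL u (snd b) - KL u y = (\<Sum>i<m. u i * (ln (y i) - ln (snd b i)))"
      by (simp add: KL_def algebra_simps flip: sum_subtractf)
    also have "\<dots> = (\<Sum>i<m. u i * (g x i - ln (Z x)))"
      by (intro sum.cong) (auto simp: lny)
    finally have 1: "KL u (snd b) - KL u y = (\<Sum>i<m. u i * g x i) - ln (Z x) * (\<Sum>i<m. u i)"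
      by (simp add: algebra_simps sum_subtractf sum_distrib_left)
    have "KL y (snd b) = (\<Sum>i<m. y i * (g x i - ln (Z x)))"
      unfolding KL_def by (intro sum.cong) (auto simp: lny)
    then have 2: "KL y (snd b) = (\<Sum>i<m. y i * g x i) - ln (Z x) * (\<Sum>i<m. y i)"
      by (simp add: algebra_simps sum_subtractf sum_distrib_left)
    have "(\<Sum>i<m. u i) = 1" using that by (simp add: splx_def)
    then show ?thesis using 1 2 ysum by (simp add: algebra_simps sum_subtractf)
  qed
  have xpart: "(\<Sum>j<n. ((\<Sum>i<m. M i j * y i) + p j) * (x j - u j))
      \<le> sqn (\<lambda>j. u j - fst b j) / 2 - sqn (\<lambda>j. u j - x j) / 2 - sqn (\<lambda>j. x j - fst b j) / 2"
    if u: "u \<in> bal" for u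
  proof -
    \<comment> \<open>The direction vanishes from \<open>n\<close> on, so the perturbed point keeps
      its zero tail and stays in \<open>K\<close>.\<close>
    define d where "d j = (if j < n then u j - x j else 0)" for j
    define c where "c i = (\<Sum>j<n. M i j * d j)" for i
    define a where "a = (\<Sum>j<n. (p j + (x j - fst b j)) * d j) + (\<Sum>i<m. y i * c i)"
    define k where "k = sqn d / 2 + (\<Sum>i<m. y i * (c i)\<^sup>2)"
    define cs where "cs = (\<Sum>i<m. \<bar>c i\<bar>)"
    \<comment> \<open>Up to \<open>t0\<close> all exponents \<open>t * c i\<close> are at most 1, as
      \<open>exp_le_quadratic\<close> requires.\<close>
    define t0 where "t0 = 1 / (1 + cs)"
    have s0: "0 \<le> cs" by (simp add: cs_def sum_nonneg)
    from s0 have t01: "0 < t0" "t0 \<le> 1" by (simp_all add: t0_def)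
    have "0 \<le> t * a + t\<^sup>2 * k" if t: "0 < t" "t \<le> t0" for t
    proof -
      have "(\<lambda>j. x j + t * d j) \<in> K"
      proof -
        have "sqn (\<lambda>j. x j + t * d j) = sqn (\<lambda>j. x j + t * (u j - x j))"
          by (simp add: sqn_def d_def)
        then show ?thesis
          using bal_convex[OF xb u, of t] t t01 x by (auto simp: K_def bal_def d_def)
      qed
      then have "\<Phi> x \<le> \<Phi> (\<lambda>j. x j + t * d j)" by (rule xmin)
      moreover have "ln (Z (\<lambda>j. x j + t * d j)) - ln (Z x) \<le> t * (\<Sum>i<m. y i * c i) + t\<^sup>2 * (\<Sum>i<m. y i * (c i)\<^sup>2)"
      proof -
        have gexp: "g (\<lambda>j. x j + t * d j) i = g x i + t * c i" for i
          by (simp add: g_def c_def algebra_simps sum.distrib sum_distrib_left)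
        have "Z (\<lambda>j. x j + t * d j) / Z x = (\<Sum>i<m. y i * exp (t * c i))"
          by (simp add: Z_def[of "\<lambda>j. x j + t * d j"] gexp exp_add y_def sum_divide_distrib mult_ac)
        moreover have "(\<Sum>i<m. y i * exp (t * c i)) \<le> (\<Sum>i<m. y i * (1 + t * c i + (t * c i)\<^sup>2))"
        proof (intro sum_mono mult_left_mono exp_le_quadratic)
          fix i assume "i \<in> {..<m}"
          then have "\<bar>c i\<bar> \<le> cs" unfolding cs_def by (intro member_le_sum) auto
          then have "t * c i \<le> t * (1 + cs)" using t by (intro mult_left_mono) auto
          also have "\<dots> \<le> t0 * (1 + cs)" using t s0 by (intro mult_right_mono) auto
          also have "\<dots> = 1" using s0 by (simp add: t0_def)
          finally show "t * c i \<le> 1" .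
          show "0 \<le> y i" using ypos \<open>i \<in> {..<m}\<close> by (simp add: less_imp_le)
        qed
        moreover have "\<dots> = 1 + (t * (\<Sum>i<m. y i * c i) + t\<^sup>2 * (\<Sum>i<m. y i * (c i)\<^sup>2))"
          using ysum by (simp add: algebra_simps sum.distrib sum_distrib_left power_mult_distrib)
        moreover have "ln (Z (\<lambda>j. x j + t * d j)) - ln (Z x) = ln (Z (\<lambda>j. x j + t * d j) / Z x)"
          using Zpos by (simp add: ln_div less_imp_neq[OF Zpos, symmetric])
        moreover have "ln (Z (\<lambda>j. x j + t * d j) / Z x) \<le> Z (\<lambda>j. x j + t * d j) / Z x - 1"
          using Zpos by (intro ln_le_minus_one) simp
        ultimately show ?thesis by linarith
      qed
      moreover have "(\<Sum>j<n. p j * (x j + t * d j)) - (\<Sum>j<n. p j * x j) = t * (\<Sum>j<n. p j * d j)"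
        by (simp add: algebra_simps sum.distrib sum_distrib_left)
      moreover have "sqn (\<lambda>j. x j + t * d j - fst b j) / 2 - sqn (\<lambda>j. x j - fst b j) / 2
          = t * (\<Sum>j<n. (x j - fst b j) * d j) + t\<^sup>2 * (sqn d / 2)"
      proof -
        have "(x j + t * d j - fst b j)\<^sup>2 = (x j - fst b j)\<^sup>2 + 2 * (t * ((x j - fst b j) * d j)) + t\<^sup>2 * (d j)\<^sup>2" for j
          by (simp add: power2_eq_square algebra_simps)
        then show ?thesis
          by (simp add: sqn_def sum.distrib add_divide_distrib flip: sum_distrib_left)
      qed
      ultimately have "0 \<le> t * (\<Sum>j<n. p j * d j)
          + (t * (\<Sum>j<n. (x j - fst b j) * d j) + t\<^sup>2 * (sqn d / 2))
          + (t * (\<Sum>i<m. y i * c i) + t\<^sup>2 * (\<Sum>i<m. y i * (c i)\<^sup>2))"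
        unfolding \<Phi>_def by linarith
      moreover have "a = (\<Sum>j<n. p j * d j) + (\<Sum>j<n. (x j - fst b j) * d j) + (\<Sum>i<m. y i * c i)"
        by (simp add: a_def distrib_right sum.distrib)
      ultimately show ?thesis unfolding k_def by (simp add: distrib_left)
    qed
    then have "0 \<le> a" using nonneg_of_small_perturbation[OF t01(1)] by blast
    moreover have "(\<Sum>i<m. y i * c i) = (\<Sum>j<n. (\<Sum>i<m. M i j * y i) * d j)"
      unfolding c_def sum_distrib_left sum_distrib_right
      by (subst sum.swap) (simp add: mult_ac)
    ultimately have "0 \<le> (\<Sum>j<n. ((\<Sum>i<m. M i j * y i) + p j + (x j - fst b j)) * d j)"
      unfolding a_def by (simp add: distrib_right sum.distrib)
    also have "\<dots> = (\<Sum>j<n. - (((\<Sum>i<m. M i j * y i) + p j) * (x j - u j))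
        + ((u j - fst b j)\<^sup>2 / 2 - (u j - x j)\<^sup>2 / 2 - (x j - fst b j)\<^sup>2 / 2))"
      by (intro sum.cong) (auto simp: d_def field_simps power2_eq_square)
    also have "\<dots> = - (\<Sum>j<n. ((\<Sum>i<m. M i j * y i) + p j) * (x j - u j)) +
      (sqn (\<lambda>j. u j - fst b j) / 2 - sqn (\<lambda>j. u j - x j) / 2 - sqn (\<lambda>j. x j - fst b j) / 2)"
      by (simp only: sqn_def sum.distrib sum_subtractf sum_negf sum_divide_distrib)
    finally show ?thesis by simp
  qed
  have "prox (\<lambda>j. (\<Sum>i<m. M i j * y i) + p j) (\<lambda>i. (\<Sum>j<n. M i j * x j) + s i) b (x, y)"
    unfolding prox_def
  proof (intro conjI ballI)
    show "(x, y) \<in> bal \<times> isplx" using xb yi by simp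
    fix u assume "u \<in> bal \<times> splx"
    then show "lin (\<lambda>j. (\<Sum>i<m. M i j * y i) + p j) (\<lambda>i. (\<Sum>j<n. M i j * x j) + s i) (x, y) u
        \<le> V b u - V (x, y) u - V b (x, y)"
      using xpart[of "fst u"] ypart[of "snd u"] unfolding lin_def V_def g_def by auto
  qed
  then show ?thesis by (intro exI[of _ "(x, y)"]) simp
qed

section \<open>Implicit steps on a modelled game and the choice of their size\<close>

definition model_step :: "(nat \<Rightarrow> nat \<Rightarrow> real) \<Rightarrow> (nat \<Rightarrow> real) \<Rightarrow> (nat \<Rightarrow> real) \<Rightarrow>
    (nat \<Rightarrow> real) \<times> (nat \<Rightarrow> real) \<Rightarrow> real \<Rightarrow> (nat \<Rightarrow> real) \<times> (nat \<Rightarrow> real) \<Rightarrow> bool" where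
  "model_step M p s b \<eta> z \<longleftrightarrow>
     prox (\<lambda>j. \<eta> * ((\<Sum>i<m. M i j * snd z i) + p j)) (\<lambda>i. \<eta> * ((\<Sum>j<n. M i j * fst z j) + s i)) b z"

definition dst :: "(nat \<Rightarrow> real) \<times> (nat \<Rightarrow> real) \<Rightarrow> (nat \<Rightarrow> real) \<times> (nat \<Rightarrow> real) \<Rightarrow> real" where
  "dst z w = sqrt (sqn (\<lambda>j. fst z j - fst w j) + he (snd z) (snd w))"

lemma model_step_exists:
  assumes "b \<in> bal \<times> isplx"
  shows "\<exists>z. model_step M p s b \<eta> z"
  using prox_exists[OF assms, of "\<lambda>i j. \<eta> * M i j" "\<lambda>j. \<eta> * p j" "\<lambda>i. \<eta> * s i"]
  by (simp add: model_step_def distrib_left sum_distrib_left mult.assoc)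

lemma lin_scale: "lin (\<lambda>j. c * gx j) (\<lambda>i. c * gy i) z u = c * lin gx gy z u"
  by (simp add: lin_def sum_distrib_left right_diff_distrib mult.assoc)

lemma V_self [simp]: "V b b = 0"
  by (simp add: V_def sqn_def KL_def)

lemma sqn_diff_commute: "sqn (\<lambda>j. x j - y j) = sqn (\<lambda>j. y j - x j)"
  by (simp add: sqn_def power2_commute)

lemma dst_commute: "dst z w = dst w z"
  by (simp add: dst_def sqn_diff_commute[of "fst z"] he_sym)

lemma dst_nonneg [simp]: "0 \<le> dst z w"
  by (simp add: dst_def)

lemma dst_triangle: "dst z w \<le> dst z v + dst v w"
proof -
  let ?a = "\<lambda>j. fst z j - fst v j" and ?b = "\<lambda>j. fst v j - fst w j"
  let ?c = "\<lambda>i. sqrt (snd z i) - sqrt (snd v i)" and ?d = "\<lambda>i. sqrt (snd v i) - sqrt (snd w i)"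
  have "sqn (\<lambda>j. fst z j - fst w j) \<le> (L2_set ?a {..<n} + L2_set ?b {..<n})\<^sup>2"
    using L2_set_triangle_ineq[of ?a ?b "{..<n}"]
    by (auto simp: sqn_def L2_set_def real_sqrt_le_iff intro: real_le_lsqrt sqrt_le_D)
  moreover have "he (snd z) (snd w) \<le> (L2_set ?c {..<m} + L2_set ?d {..<m})\<^sup>2"
    using L2_set_triangle_ineq[of ?c ?d "{..<m}"]
    by (auto simp: he_def L2_set_def intro: sqrt_le_D)
  ultimately have "dst z w \<le> sqrt ((L2_set ?a {..<n} + L2_set ?b {..<n})\<^sup>2 + (L2_set ?c {..<m} + L2_set ?d {..<m})\<^sup>2)"
    unfolding dst_def by (intro real_sqrt_le_mono add_mono)
  also have "\<dots> \<le> sqrt ((L2_set ?a {..<n})\<^sup>2 + (L2_set ?c {..<m})\<^sup>2) + sqrt ((L2_set ?b {..<n})\<^sup>2 + (L2_set ?d {..<m})\<^sup>2)"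
    by (rule real_sqrt_sum_squares_triangle_ineq)
  also have "\<dots> = dst z v + dst v w"
    by (simp add: dst_def sqn_def he_def L2_set_def sum_nonneg)
  finally show ?thesis .
qed

lemma dst_sq_le_V:
  assumes "u \<in> bal \<times> splx" "b \<in> bal \<times> isplx"
  shows "(dst u b)\<^sup>2 \<le> 2 * V b u"
  using V_ge[OF assms] he_nonneg[of "snd u" "snd b"] sqn_nonneg[of "\<lambda>j. fst u j - fst b j"]
  unfolding dst_def by (subst real_sqrt_pow2) linarith+

lemma isplx_times: "z \<in> bal \<times> isplx \<Longrightarrow> z \<in> bal \<times> splx"
  using isplx_subset by auto

lemma abs_le_one_bal: "x \<in> bal \<Longrightarrow> j < n \<Longrightarrow> \<bar>x j\<bar> \<le> 1"
  using member_le_sum[of j "{..<n}" "\<lambda>j. (x j)\<^sup>2"]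
  by (simp add: bal_def sqn_def flip: abs_square_le_1)

lemma abs_le_one_splx: "y \<in> splx \<Longrightarrow> i < m \<Longrightarrow> \<bar>y i\<bar> \<le> 1"
  using member_le_sum[of i "{..<m}" y]
  by (auto simp: splx_def)

text \<open>The bilinear part of the operator is skew: its increment from \<open>w\<close> to
  \<open>z\<close> is annihilated by \<open>z - w\<close>, so the gradient may be taken at either
  point.\<close>

lemma lin_skew:
  "lin (\<lambda>j. (\<Sum>i<m. M i j * snd z i) + p j) (\<lambda>i. (\<Sum>j<n. M i j * fst z j) + s i) z w
   = lin (\<lambda>j. (\<Sum>i<m. M i j * snd w i) + p j) (\<lambda>i. (\<Sum>j<n. M i j * fst w j) + s i) z w"
proof -
  have "(\<Sum>j<n. ((\<Sum>i<m. M i j * snd z i) + p j) * (fst z j - fst w j))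
      - (\<Sum>j<n. ((\<Sum>i<m. M i j * snd w i) + p j) * (fst z j - fst w j))
      = (\<Sum>j<n. \<Sum>i<m. M i j * (snd z i - snd w i) * (fst z j - fst w j))"
    by (simp add: sum_distrib_right algebra_simps flip: sum_subtractf)
       (simp add: sum_subtractf algebra_simps sum_distrib_left sum.distrib)
  also have "\<dots> = (\<Sum>i<m. \<Sum>j<n. M i j * (snd z i - snd w i) * (fst z j - fst w j))"
    by (rule sum.swap)
  also have "\<dots> = (\<Sum>i<m. ((\<Sum>j<n. M i j * fst z j) + s i) * (snd z i - snd w i))
      - (\<Sum>i<m. ((\<Sum>j<n. M i j * fst w j) + s i) * (snd z i - snd w i))"
    by (simp add: sum_distrib_right algebra_simps flip: sum_subtractf)
       (simp add: sum_subtractf algebra_simps sum_distrib_left sum.distrib)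
  finally show ?thesis by (simp add: lin_def)
qed

text \<open>Each three-point inequality is tested with the other solution. The center terms cancel,
  by skewness the linear terms combine to a multiple of \<open>\<eta>2 - \<eta>1\<close>, and the
  bounded domain controls its factor. This is Hoelder continuity in the step size.\<close>

lemma model_step_stable:
  assumes b: "b \<in> bal \<times> isplx"
    and 1: "model_step M p s b \<eta>1 z1" and 2: "model_step M p s b \<eta>2 z2"
  shows "(dst z1 z2)\<^sup>2 \<le> \<bar>\<eta>1 - \<eta>2\<bar> *
    (2 * (\<Sum>j<n. (\<Sum>i<m. \<bar>M i j\<bar>) + \<bar>p j\<bar>) + 2 * (\<Sum>i<m. (\<Sum>j<n. \<bar>M i j\<bar>) + \<bar>s i\<bar>))"
    (is "_ \<le> _ * ?K")
proof -
  define g where "g z = lin (\<lambda>j. (\<Sum>i<m. M i j * snd z i) + p j) (\<lambda>i. (\<Sum>j<n. M i j * fst z j) + s i)" for z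
  have d1: "z1 \<in> bal \<times> isplx" and d2: "z2 \<in> bal \<times> isplx"
    using 1 2 by (auto simp: model_step_def prox_def)
  have "\<eta>1 * g z1 z1 z2 \<le> V b z2 - V z1 z2 - V b z1"
    using 1 isplx_times[OF d2] unfolding model_step_def prox_def lin_scale g_def by blast
  moreover have "\<eta>2 * g z2 z2 z1 \<le> V b z1 - V z2 z1 - V b z2"
    using 2 isplx_times[OF d1] unfolding model_step_def prox_def lin_scale g_def by blast
  moreover have "g z2 z2 z1 = - g z1 z1 z2"
    using lin_skew[of M z1 p s z2] unfolding g_def by (simp add: lin_def algebra_simps sum_subtractf)
  ultimately have "V z1 z2 + V z2 z1 \<le> (\<eta>2 - \<eta>1) * g z1 z1 z2"
    by (simp add: algebra_simps)
  also have "\<dots> \<le> \<bar>\<eta>1 - \<eta>2\<bar> * \<bar>g z1 z1 z2\<bar>"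
    by (metis abs_ge_self abs_minus_commute abs_mult)
  also have "\<dots> \<le> \<bar>\<eta>1 - \<eta>2\<bar> * ?K"
  proof (intro mult_left_mono)
    have x: "\<bar>fst z1 j - fst z2 j\<bar> \<le> 2" "\<bar>fst z1 j\<bar> \<le> 1" if "j < n" for j
      using abs_le_one_bal[of "fst z1" j] abs_le_one_bal[of "fst z2" j] d1 d2 that by auto
    have y: "\<bar>snd z1 i - snd z2 i\<bar> \<le> 2" "\<bar>snd z1 i\<bar> \<le> 1" if "i < m" for i
      using abs_le_one_splx[of "snd z1" i] abs_le_one_splx[of "snd z2" i] isplx_times[OF d1] isplx_times[OF d2] that by auto
    have "\<bar>(\<Sum>j<n. ((\<Sum>i<m. M i j * snd z1 i) + p j) * (fst z1 j - fst z2 j))\<bar>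
        \<le> 2 * (\<Sum>j<n. ((\<Sum>i<m. \<bar>M i j\<bar>) + \<bar>p j\<bar>))"
      unfolding sum_distrib_left
    proof (rule order_trans[OF sum_abs sum_mono])
      fix j assume j: "j \<in> {..<n}"
      have "\<bar>\<Sum>i<m. M i j * snd z1 i\<bar> \<le> (\<Sum>i<m. \<bar>M i j\<bar>)"
        by (rule order_trans[OF sum_abs sum_mono]) (use y in \<open>auto simp: abs_mult mult_left_le\<close>)
      then have "\<bar>(\<Sum>i<m. M i j * snd z1 i) + p j\<bar> \<le> (\<Sum>i<m. \<bar>M i j\<bar>) + \<bar>p j\<bar>" by linarith
      then show "\<bar>((\<Sum>i<m. M i j * snd z1 i) + p j) * (fst z1 j - fst z2 j)\<bar> \<le> 2 * ((\<Sum>i<m. \<bar>M i j\<bar>) + \<bar>p j\<bar>)"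
        unfolding abs_mult mult.commute[of 2] using x j by (intro mult_mono) auto
    qed
    moreover have "\<bar>(\<Sum>i<m. ((\<Sum>j<n. M i j * fst z1 j) + s i) * (snd z1 i - snd z2 i))\<bar>
        \<le> 2 * (\<Sum>i<m. ((\<Sum>j<n. \<bar>M i j\<bar>) + \<bar>s i\<bar>))"
      unfolding sum_distrib_left
    proof (rule order_trans[OF sum_abs sum_mono])
      fix i assume i: "i \<in> {..<m}"
      have "\<bar>\<Sum>j<n. M i j * fst z1 j\<bar> \<le> (\<Sum>j<n. \<bar>M i j\<bar>)"
        by (rule order_trans[OF sum_abs sum_mono]) (use x in \<open>auto simp: abs_mult mult_left_le\<close>)
      then have "\<bar>(\<Sum>j<n. M i j * fst z1 j) + s i\<bar> \<le> (\<Sum>j<n. \<bar>M i j\<bar>) + \<bar>s i\<bar>" by linarith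
      then show "\<bar>((\<Sum>j<n. M i j * fst z1 j) + s i) * (snd z1 i - snd z2 i)\<bar> \<le> 2 * ((\<Sum>j<n. \<bar>M i j\<bar>) + \<bar>s i\<bar>)"
        unfolding abs_mult mult.commute[of 2] using y i by (intro mult_mono) auto
    qed
    ultimately show "\<bar>g z1 z1 z2\<bar> \<le> ?K"
      unfolding g_def lin_def by linarith
  qed simp
  finally have "V z1 z2 + V z2 z1 \<le> \<bar>\<eta>1 - \<eta>2\<bar> * ?K" .
  moreover have "(dst z1 z2)\<^sup>2 \<le> 2 * V z1 z2" "(dst z1 z2)\<^sup>2 \<le> 2 * V z2 z1"
    using dst_sq_le_V[OF isplx_times[OF d1] d2] dst_sq_le_V[OF isplx_times[OF d2] d1]
    by (simp_all add: dst_commute)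
  ultimately show ?thesis by linarith
qed

text \<open>Step size 0 stays at \<open>b\<close>, and the distance travelled is continuous in the
  step size, so the intermediate value theorem gives either the full step or one of length exactly
  \<open>r\<close>.\<close>

lemma capped_model_step:
  assumes b: "b \<in> bal \<times> isplx" and "0 < r" and "0 < \<eta>m"
  shows "\<exists>\<eta> z. 0 \<le> \<eta> \<and> \<eta> \<le> \<eta>m \<and> model_step M p s b \<eta> z \<and> dst z b \<le> r \<and> (\<eta> = \<eta>m \<or> dst z b = r)"
proof -
  obtain z where z: "\<And>\<eta>. model_step M p s b \<eta> (z \<eta>)"
    using model_step_exists[OF b] by metis
  obtain K where K: "0 \<le> K" "\<And>\<eta>1 \<eta>2. (dst (z \<eta>1) (z \<eta>2))\<^sup>2 \<le> \<bar>\<eta>1 - \<eta>2\<bar> * K"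
  proof
    let ?K = "2 * (\<Sum>j<n. (\<Sum>i<m. \<bar>M i j\<bar>) + \<bar>p j\<bar>) + 2 * (\<Sum>i<m. (\<Sum>j<n. \<bar>M i j\<bar>) + \<bar>s i\<bar>)"
    show "0 \<le> ?K" by (auto intro!: add_nonneg_nonneg sum_nonneg)
    show "(dst (z \<eta>1) (z \<eta>2))\<^sup>2 \<le> \<bar>\<eta>1 - \<eta>2\<bar> * ?K" for \<eta>1 \<eta>2
      using model_step_stable[OF b z z] .
  qed
  have z0: "dst (z 0) b = 0"
  proof -
    have "prox (\<lambda>j. 0) (\<lambda>i. 0) b (z 0)" using z[of 0] by (simp add: model_step_def)
    then have d: "z 0 \<in> bal \<times> isplx" and "lin (\<lambda>j. 0) (\<lambda>i. 0) (z 0) b \<le> V b b - V (z 0) b - V b (z 0)"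
      unfolding prox_def using isplx_times[OF b] by blast+
    then have "V b (z 0) \<le> 0"
      using V_nonneg[OF isplx_times[OF b] d] by (simp add: lin_def)
    then have "(dst (z 0) b)\<^sup>2 \<le> 0" using dst_sq_le_V[OF isplx_times[OF d] b] by linarith
    then show ?thesis by simp
  qed
  have cont: "continuous_on {0..\<eta>m} (\<lambda>\<eta>. dst (z \<eta>) b)"
    unfolding continuous_on_def
  proof (intro ballI tendstoI)
    fix x e :: real assume "x \<in> {0..\<eta>m}" "0 < e"
    show "\<forall>\<^sub>F x' in at x within {0..\<eta>m}. dist (dst (z x') b) (dst (z x) b) < e"
      unfolding eventually_at
    proof (intro exI[of _ "e\<^sup>2 / (K + 1)"] conjI ballI impI)
      show "0 < e\<^sup>2 / (K + 1)" using \<open>0 < e\<close> K(1) by simp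
      fix x' assume "x' \<noteq> x \<and> dist x' x < e\<^sup>2 / (K + 1)"
      then have "\<bar>x' - x\<bar> * (K + 1) < e\<^sup>2"
        using K(1) pos_less_divide_eq[of "K + 1" "\<bar>x' - x\<bar>" "e\<^sup>2"] by (auto simp: dist_real_def)
      moreover have "\<bar>x' - x\<bar> * K \<le> \<bar>x' - x\<bar> * (K + 1)" by (intro mult_left_mono) auto
      ultimately have "(dst (z x') (z x))\<^sup>2 < e\<^sup>2"
        using K(2)[of x' x] by linarith
      then have "dst (z x') (z x) < e"
        using \<open>0 < e\<close> by (simp add: power_less_imp_less_base)
      then show "dist (dst (z x') b) (dst (z x) b) < e"
        using dst_triangle[of "z x'" b "z x"] dst_triangle[of "z x" b "z x'"]
        by (simp add: dist_real_def dst_commute[of "z x" "z x'"])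
    qed
  qed
  show ?thesis
  proof (cases "dst (z \<eta>m) b \<le> r")
    case True
    then show ?thesis using z assms(3) by (intro exI[of _ \<eta>m] exI[of _ "z \<eta>m"]) auto
  next
    case False
    then obtain \<eta> where "0 \<le> \<eta>" "\<eta> \<le> \<eta>m" "dst (z \<eta>) b = r"
      using IVT'[of "\<lambda>\<eta>. dst (z \<eta>) b" 0 r \<eta>m] cont z0 assms by auto
    then show ?thesis using z by (intro exI[of _ \<eta>] exI[of _ "z \<eta>"]) auto
  qed
qed

section \<open>Averages and barycenters\<close>

lemma bal_average:
  assumes "finite S" "\<And>k. k \<in> S \<Longrightarrow> 0 \<le> w k" "(\<Sum>k\<in>S. w k) = 1" "\<And>k. k \<in> S \<Longrightarrow> x k \<in> bal"
  shows "(\<lambda>j. \<Sum>k\<in>S. w k * x k j) \<in> bal"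
proof -
  have "(\<Sum>k\<in>S. w k * x k j)\<^sup>2 \<le> (\<Sum>k\<in>S. w k * (x k j)\<^sup>2)" for j
  proof -
    define c where "c = (\<Sum>k\<in>S. w k * x k j)"
    \<comment> \<open>Nonnegativity of the weighted variance is Jensen's inequality for the
      square.\<close>
    have "0 \<le> (\<Sum>k\<in>S. w k * (x k j - c)\<^sup>2)" using assms by (intro sum_nonneg) auto
    also have "\<dots> = (\<Sum>k\<in>S. w k * (x k j)\<^sup>2 - 2 * c * (w k * x k j) + c\<^sup>2 * w k)"
      by (intro sum.cong) (auto simp: power2_eq_square algebra_simps)
    also have "\<dots> = (\<Sum>k\<in>S. w k * (x k j)\<^sup>2) - 2 * c * c + c\<^sup>2 * 1"
      by (simp add: sum.distrib sum_subtractf c_def assms(3) flip: sum_distrib_left)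
    finally show ?thesis by (simp add: c_def power2_eq_square)
  qed
  then have "sqn (\<lambda>j. \<Sum>k\<in>S. w k * x k j) \<le> (\<Sum>j<n. \<Sum>k\<in>S. w k * (x k j)\<^sup>2)"
    unfolding sqn_def by (intro sum_mono)
  also have "\<dots> = (\<Sum>k\<in>S. w k * sqn (x k))"
    by (subst sum.swap) (simp add: sqn_def sum_distrib_left)
  also have "\<dots> \<le> (\<Sum>k\<in>S. w k * 1)"
    using assms by (intro sum_mono mult_left_mono) (auto simp: bal_def)
  finally show ?thesis using assms(3) by (simp add: bal_def)
qed

lemma splx_average:
  assumes "finite S" "\<And>k. k \<in> S \<Longrightarrow> 0 \<le> w k" "(\<Sum>k\<in>S. w k) = 1" "\<And>k. k \<in> S \<Longrightarrow> y k \<in> splx"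
  shows "(\<lambda>i. \<Sum>k\<in>S. w k * y k i) \<in> splx"
proof -
  have "(\<Sum>i<m. \<Sum>k\<in>S. w k * y k i) = (\<Sum>k\<in>S. w k * (\<Sum>i<m. y k i))"
    by (subst sum.swap) (simp add: sum_distrib_left)
  also have "\<dots> = 1" using assms by (simp add: splx_def)
  finally show ?thesis using assms by (auto simp: splx_def intro!: sum_nonneg)
qed

text \<open>The minimizer of the summed divergences to several centers: arithmetic mean in the ball,
  normalized geometric mean in the simplex.\<close>

definition bary :: "'i set \<Rightarrow> ('i \<Rightarrow> (nat \<Rightarrow> real) \<times> (nat \<Rightarrow> real)) \<Rightarrow> (nat \<Rightarrow> real) \<times> (nat \<Rightarrow> real)" where
  "bary S c = (let geo = \<lambda>i. exp ((\<Sum>k\<in>S. ln (snd (c k) i)) / card S) in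
     (\<lambda>j. \<Sum>k\<in>S. 1 / card S * fst (c k) j, \<lambda>i. geo i / (\<Sum>i<m. geo i)))"

text \<open>A parallel axis theorem: as a function of \<open>u\<close>, the sum of the divergences
  to several centers is a multiple of a single divergence plus a constant. A proximal step from the
  barycenter is thus regularized towards all the centers.\<close>

lemma bary:
  assumes "finite S" "S \<noteq> {}" and c: "\<And>k. k \<in> S \<Longrightarrow> c k \<in> bal \<times> isplx"
  shows bary_mem: "bary S c \<in> bal \<times> isplx"
    and bary_split: "u \<in> bal \<times> splx \<Longrightarrow>
      (\<Sum>k\<in>S. V (c k) u) = card S * V (bary S c) u + (\<Sum>k\<in>S. V (c k) (bary S c))"
proof -
  define N where "N = real (card S)"
  have N: "0 < N" using assms by (simp add: N_def card_gt_0_iff)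
  define geo where "geo i = exp ((\<Sum>k\<in>S. ln (snd (c k) i)) / N)" for i
  define Z where "Z = (\<Sum>i<m. geo i)"
  define X where "X j = (\<Sum>k\<in>S. 1 / N * fst (c k) j)" for j
  define Y where "Y i = geo i / Z" for i
  have b: "bary S c = (X, Y)"
    by (simp add: bary_def Let_def fun_eq_iff X_def Y_def geo_def Z_def N_def)
  have Z: "0 < Z" unfolding Z_def geo_def using m_pos by (intro sum_pos) auto
  have Xb: "X \<in> bal"
    unfolding X_def using assms(1) N c by (intro bal_average) (auto simp: N_def mem_Times_iff)
  have Yi: "Y \<in> isplx"
    using Z by (auto simp: isplx_def Y_def geo_def Z_def simp flip: sum_divide_distrib)
  show mem: "bary S c \<in> bal \<times> isplx" using Xb Yi b by simp
  \<comment> \<open>For the geometric mean the logarithms of the centers sum to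
    \<open>N * (ln (Y i) + ln Z)\<close>; taking \<open>v = Y\<close> below identifies the
    constant.\<close>
  have ypart: "(\<Sum>k\<in>S. KL v (snd (c k))) = N * KL v Y - N * ln Z" if "v \<in> splx" for v
  proof -
    have "(\<Sum>k\<in>S. KL v (snd (c k))) = (\<Sum>i<m. \<Sum>k\<in>S. v i * (ln (v i) - ln (snd (c k) i)))"
      unfolding KL_def by (rule sum.swap)
    also have "\<dots> = (\<Sum>i<m. N * (v i * (ln (v i) - ln (Y i))) - N * ln Z * v i)"
    proof (rule sum.cong, simp)
      fix i
      have "ln (Y i) = (\<Sum>k\<in>S. ln (snd (c k) i)) / N - ln Z"
        using Z by (simp add: Y_def geo_def ln_div)
      then have "(\<Sum>k\<in>S. ln (snd (c k) i)) = N * (ln (Y i) + ln Z)" using N by simp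
      then show "(\<Sum>k\<in>S. v i * (ln (v i) - ln (snd (c k) i))) = N * (v i * (ln (v i) - ln (Y i))) - N * ln Z * v i"
        by (simp add: sum_subtractf N_def algebra_simps flip: sum_distrib_left)
    qed
    also have "\<dots> = N * KL v Y - N * ln Z * (\<Sum>i<m. v i)"
      by (simp add: sum_subtractf KL_def flip: sum_distrib_left)
    finally show ?thesis using that by (simp add: splx_def)
  qed
  have xpart: "(\<Sum>k\<in>S. sqn (\<lambda>j. v j - fst (c k) j))
     = N * sqn (\<lambda>j. v j - X j) + (\<Sum>k\<in>S. sqn (\<lambda>j. X j - fst (c k) j))" for v
  proof -
    have "(\<Sum>k\<in>S. (v j - fst (c k) j)\<^sup>2) = N * (v j - X j)\<^sup>2 + (\<Sum>k\<in>S. (X j - fst (c k) j)\<^sup>2)" for j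
    proof -
      have "(\<Sum>k\<in>S. (v j - fst (c k) j)\<^sup>2)
        = (\<Sum>k\<in>S. (v j - X j)\<^sup>2 + (X j - fst (c k) j)\<^sup>2 + 2 * (v j - X j) * (X j - fst (c k) j))"
        by (intro sum.cong) (auto simp: power2_eq_square algebra_simps)
      also have "\<dots> = N * (v j - X j)\<^sup>2 + (\<Sum>k\<in>S. (X j - fst (c k) j)\<^sup>2)
          + 2 * (v j - X j) * (N * X j - (\<Sum>k\<in>S. fst (c k) j))"
        by (simp add: sum.distrib sum_subtractf N_def flip: sum_distrib_left)
      also have "N * X j = (\<Sum>k\<in>S. fst (c k) j)" using N by (simp add: X_def flip: sum_divide_distrib)
      finally show ?thesis by simp
    qed
    then show ?thesis
      unfolding sqn_def by (subst (1 2) sum.swap) (simp add: sum.distrib sum_distrib_left)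
  qed
  show "(\<Sum>k\<in>S. V (c k) u) = card S * V (bary S c) u + (\<Sum>k\<in>S. V (c k) (bary S c))"
    if u: "u \<in> bal \<times> splx"
  proof -
    have expand: "(\<Sum>k\<in>S. V (c k) v)
        = (\<Sum>k\<in>S. sqn (\<lambda>j. fst v j - fst (c k) j)) / 2 + (\<Sum>k\<in>S. KL (snd v) (snd (c k)))" for v
      unfolding V_def sum.distrib sum_divide_distrib ..
    have "Y \<in> splx" using Yi isplx_subset by auto
    then have "(\<Sum>k\<in>S. KL Y (snd (c k))) = - (N * ln Z)" using ypart[of Y] by (simp add: KL_def)
    moreover have "(\<Sum>k\<in>S. KL (snd u) (snd (c k))) = N * KL (snd u) Y - N * ln Z"
      using u by (intro ypart) auto
    moreover have "real (card S) * V (bary S c) u = N * sqn (\<lambda>j. fst u j - X j) / 2 + N * KL (snd u) Y"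
      by (simp add: V_def b N_def[symmetric] distrib_left)
    ultimately show ?thesis
      using xpart[of "fst u"] unfolding expand b fst_conv snd_conv by linarith
  qed
qed

section \<open>Extragradient steps with a partially learned matrix\<close>

definition dot :: "(nat \<Rightarrow> real) \<Rightarrow> (nat \<Rightarrow> real) \<Rightarrow> real" where
  "dot x y = (\<Sum>j<n. x j * y j)"

definition mv :: "(nat \<Rightarrow> nat \<Rightarrow> real) \<Rightarrow> (nat \<Rightarrow> real) \<Rightarrow> nat \<Rightarrow> real" where
  "mv A x i = (\<Sum>j<n. A i j * x j)"

definition mt :: "(nat \<Rightarrow> nat \<Rightarrow> real) \<Rightarrow> (nat \<Rightarrow> real) \<Rightarrow> nat \<Rightarrow> real" where
  "mt A y j = (\<Sum>i<m. A i j * y i)"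

definition rows_le_one :: "(nat \<Rightarrow> nat \<Rightarrow> real) \<Rightarrow> bool" where
  "rows_le_one A \<longleftrightarrow> (\<forall>i<m. sqn (A i) \<le> 1)"

definition orthonormal :: "(nat \<Rightarrow> nat \<Rightarrow> real) \<Rightarrow> nat \<Rightarrow> bool" where
  "orthonormal U K \<longleftrightarrow> (\<forall>k<K. \<forall>l<K. dot (U k) (U l) = (if k = l then 1 else 0))"

definition residual :: "(nat \<Rightarrow> nat \<Rightarrow> real) \<Rightarrow> nat \<Rightarrow> (nat \<Rightarrow> real) \<Rightarrow> nat \<Rightarrow> real" where
  "residual U K x j = x j - (\<Sum>k<K. dot (U k) x * U k j)"

text \<open>The matrix \<open>A P\<close>, computable from the products of \<open>A\<close> with the
  learned directions alone.\<close>

definition learned :: "(nat \<Rightarrow> nat \<Rightarrow> real) \<Rightarrow> (nat \<Rightarrow> nat \<Rightarrow> real) \<Rightarrow> nat \<Rightarrow> nat \<Rightarrow> nat \<Rightarrow> real" where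
  "learned A U K i j = (\<Sum>k<K. mv A (U k) i * U k j)"

definition wsq :: "(nat \<Rightarrow> nat \<Rightarrow> real) \<Rightarrow> (nat \<Rightarrow> real) \<Rightarrow> (nat \<Rightarrow> real) \<Rightarrow> real" where
  "wsq A w x = (\<Sum>i<m. w i * (mv A x i)\<^sup>2)"

text \<open>The linearized regret of \<open>z\<close> against \<open>u\<close>. Its supremum over
  \<open>u\<close> is the duality gap of \<open>z\<close>, and it is linear in
  \<open>z\<close>.\<close>

definition reg :: "(nat \<Rightarrow> nat \<Rightarrow> real) \<Rightarrow> (nat \<Rightarrow> real) \<times> (nat \<Rightarrow> real) \<Rightarrow>
    (nat \<Rightarrow> real) \<times> (nat \<Rightarrow> real) \<Rightarrow> real" where
  "reg A z u = (\<Sum>i<m. mv A (fst z) i * snd u i) - dot (mt A (snd z)) (fst u)"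

section \<open>Projection onto the learned directions and row-norm estimates\<close>

lemma dot_commute: "dot x y = dot y x"
  by (simp add: dot_def mult.commute)

lemma dot_diff_right: "dot x (\<lambda>j. y j - z j) = dot x y - dot x z"
  by (simp add: dot_def right_diff_distrib sum_subtractf)

lemma dot_self: "dot x x = sqn x"
  by (simp add: dot_def sqn_def power2_eq_square)

lemma dot_sum_right: "dot x (\<lambda>j. \<Sum>k\<in>S. c k * y k j) = (\<Sum>k\<in>S. c k * dot x (y k))"
  unfolding dot_def sum_distrib_left by (subst sum.swap) (simp add: mult_ac)

lemma mv_diff: "mv A (\<lambda>j. x j - y j) i = mv A x i - mv A y i"
  by (simp add: mv_def right_diff_distrib sum_subtractf)

lemma mv_eq_dot: "mv A x i = dot (A i) x"
  by (simp add: mv_def dot_def)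

lemma sum_mult_mv: "(\<Sum>i<m. y i * mv A x i) = dot (mt A y) x"
  unfolding mv_def mt_def dot_def sum_distrib_left sum_distrib_right
  by (subst sum.swap) (simp add: mult_ac)

lemma residual_diff:
  "residual U K (\<lambda>j. x j - y j) j = residual U K x j - residual U K y j"
  by (simp add: residual_def dot_diff_right left_diff_distrib sum_subtractf)

lemma residual_orthogonal:
  assumes "orthonormal U K" "l < K"
  shows "dot (U l) (residual U K x) = 0"
proof -
  have "dot (U l) (residual U K x) = dot (U l) x - (\<Sum>k<K. dot (U k) x * dot (U l) (U k))"
    unfolding residual_def by (simp add: dot_diff_right dot_sum_right)
  also have "(\<Sum>k<K. dot (U k) x * dot (U l) (U k)) = (\<Sum>k<K. if k = l then dot (U k) x else 0)"
    using assms by (intro sum.cong) (auto simp: orthonormal_def)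
  also have "\<dots> = dot (U l) x" using assms(2) by simp
  finally show ?thesis by simp
qed

lemma sqn_residual:
  assumes "orthonormal U K"
  shows "sqn (residual U K x) = dot (residual U K x) x"
    and "sqn (residual U K x) = sqn x - (\<Sum>k<K. (dot (U k) x)\<^sup>2)"
proof -
  have "dot r (residual U K x) = dot r x - (\<Sum>k<K. dot (U k) x * dot r (U k))" for r
    unfolding residual_def by (simp add: dot_diff_right dot_sum_right)
  from this[of "residual U K x"] this[of x]
  show "sqn (residual U K x) = dot (residual U K x) x"
    and "sqn (residual U K x) = sqn x - (\<Sum>k<K. (dot (U k) x)\<^sup>2)"
    using residual_orthogonal[OF assms]
    by (simp_all add: dot_self dot_commute[of "residual U K x"] dot_commute[of x "U _"] power2_eq_square)
qed

lemma sqn_residual_le: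
  assumes "orthonormal U K"
  shows "sqn (residual U K x) \<le> sqn x"
  using sqn_residual(2)[OF assms, of x] by (simp add: sum_nonneg)

lemma bessel:
  assumes "orthonormal U K"
  shows "(\<Sum>k<K. (dot (U k) x)\<^sup>2) \<le> sqn x"
  using sqn_residual(2)[OF assms, of x] sqn_nonneg[of "residual U K x"] by linarith

lemma mv_learned: "mv (learned A U K) x i = (\<Sum>k<K. mv A (U k) i * dot (U k) x)"
  unfolding mv_def[of "learned A U K"] learned_def dot_def sum_distrib_left sum_distrib_right
  by (subst sum.swap) (simp add: mult_ac)

lemma mv_residual: "mv A (residual U K x) i = mv A x i - mv (learned A U K) x i"
  unfolding mv_learned unfolding mv_eq_dot residual_def
  by (simp add: dot_diff_right dot_sum_right) (simp add: mult.commute)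

lemma mt_learned: "mt A y j - mt (learned A U K) y j = residual U K (mt A y) j"
proof -
  have "mt (learned A U K) y j = (\<Sum>k<K. (\<Sum>i<m. y i * mv A (U k) i) * U k j)"
    unfolding mt_def learned_def sum_distrib_left sum_distrib_right
    by (subst sum.swap) (simp add: mult_ac)
  then show ?thesis
    by (simp add: residual_def sum_mult_mv dot_commute)
qed

lemma dot_le_L2: "dot x y \<le> sqrt (sqn x) * sqrt (sqn y)"
  using sum_mult_le_L2_set[of x y "{..<n}"] by (simp add: dot_def sqn_def L2_set_def)

lemma abs_mv_le:
  assumes "rows_le_one A" "i < m"
  shows "\<bar>mv A x i\<bar> \<le> sqrt (sqn x)"
proof -
  have r: "sqrt (sqn (A i)) \<le> 1" using assms by (simp add: rows_le_one_def)
  have "dot (A i) x \<le> sqrt (sqn (A i)) * sqrt (sqn x)" by (rule dot_le_L2)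
  moreover have "dot (A i) (\<lambda>j. - x j) \<le> sqrt (sqn (A i)) * sqrt (sqn (\<lambda>j. - x j))" by (rule dot_le_L2)
  moreover have "sqn (\<lambda>j. - x j) = sqn x" "dot (A i) (\<lambda>j. - x j) = - dot (A i) x"
    by (simp_all add: sqn_def dot_def sum_negf)
  moreover have "sqrt (sqn (A i)) * sqrt (sqn x) \<le> 1 * sqrt (sqn x)"
    using r by (intro mult_right_mono) auto
  ultimately show ?thesis unfolding mv_eq_dot by auto
qed

lemma L2_set_mv_le:
  assumes "rows_le_one A"
  shows "L2_set (\<lambda>i. f i * mv A x i) {..<m} \<le> L2_set f {..<m} * sqrt (sqn x)"
proof -
  have "(\<Sum>i<m. (f i * mv A x i)\<^sup>2) \<le> (\<Sum>i<m. (f i)\<^sup>2 * sqn x)"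
  proof (intro sum_mono)
    fix i assume "i \<in> {..<m}"
    then have "\<bar>mv A x i\<bar>\<^sup>2 \<le> (sqrt (sqn x))\<^sup>2"
      using abs_mv_le[OF assms] by (intro power_mono) auto
    then show "(f i * mv A x i)\<^sup>2 \<le> (f i)\<^sup>2 * sqn x"
      by (simp add: power_mult_distrib mult_left_mono)
  qed
  then show ?thesis
    by (simp add: L2_set_def flip: sum_distrib_right real_sqrt_mult)
qed

section \<open>Tests of the model error: passing yields regret, failing yields a heavy
  direction\<close>

context
  fixes A U :: "nat \<Rightarrow> nat \<Rightarrow> real" and K :: nat and b z :: "(nat \<Rightarrow> real) \<times> (nat \<Rightarrow> real)"
    and \<eta> \<beta> :: real and u v :: "nat \<Rightarrow> real"
  assumes rows: "rows_le_one A" and on: "orthonormal U K"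
    and b: "b \<in> bal \<times> isplx" and z: "z \<in> bal \<times> isplx"
    and \<beta>: "0 < \<beta>" and \<eta>: "0 \<le> \<eta>" "\<eta> \<le> 1 / \<beta>" and near: "dst z b \<le> \<beta> / 8"
    and u: "u = residual U K (\<lambda>j. fst z j - fst b j)"
    and v: "v = residual U K (\<lambda>j. mt A (snd z) j - mt A (snd b) j)"
begin

private lemma near_parts: "sqrt (sqn (\<lambda>j. fst z j - fst b j)) \<le> \<beta> / 8" "sqrt (he (snd z) (snd b)) \<le> \<beta> / 8"
proof -
  have "sqrt (sqn (\<lambda>j. fst z j - fst b j)) \<le> dst z b" "sqrt (he (snd z) (snd b)) \<le> dst z b"
    unfolding dst_def by (simp_all del: real_sqrt_le_iff add: real_sqrt_le_mono)
  then show "sqrt (sqn (\<lambda>j. fst z j - fst b j)) \<le> \<beta> / 8" "sqrt (he (snd z) (snd b)) \<le> \<beta> / 8"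
    using near by linarith+
qed

private lemma sqrt_pos: "i < m \<Longrightarrow> (sqrt (snd b i))\<^sup>2 = snd b i" "i < m \<Longrightarrow> (sqrt (snd z i))\<^sup>2 = snd z i"
  using b z by (auto simp: isplx_def less_imp_le)

private lemma L2_diff_mv:
  "L2_set (\<lambda>i. (sqrt (snd z i) - sqrt (snd b i)) * mv A x i) {..<m} \<le> sqrt (he (snd z) (snd b)) * sqrt (sqn x)"
  using L2_set_mv_le[OF rows, of "\<lambda>i. sqrt (snd z i) - sqrt (snd b i)" x] by (simp add: he_def L2_set_def)

private lemma L2_wsq: "L2_set (\<lambda>i. sqrt (snd b i) * mv A x i) {..<m} = sqrt (wsq A (snd b) x)"
  unfolding L2_set_def wsq_def by (intro arg_cong[of _ _ sqrt] sum.cong) (auto simp: power_mult_distrib sqrt_pos)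

private lemma weight_conclude:
  assumes "\<beta> / 8 * sqrt (sqn x) \<le> sqrt (wsq A (snd b) x)"
  shows "\<beta>\<^sup>2 / 64 * sqn x \<le> wsq A (snd b) x"
proof -
  have "(\<beta> / 8 * sqrt (sqn x))\<^sup>2 \<le> (sqrt (wsq A (snd b) x))\<^sup>2"
    using assms \<beta> by (intro power_mono) auto
  moreover have "0 \<le> wsq A (snd b) x"
    using isplx_times[OF b] by (auto simp: wsq_def splx_def intro!: sum_nonneg)
  ultimately show ?thesis by (simp add: power_mult_distrib power_divide)
qed

text \<open>\<open>v\<close> is the error of the model in \<open>mt A\<close> along the simplex
  move. Pairing it with itself and factoring \<open>snd z i - snd b i\<close> through square roots
  gives \<open>a\<^sup>2 \<le> h * (h * a + 2 * w)\<close>. A failed test means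
  \<open>h < 2 * \<eta> * a\<close>; with the cap \<open>h \<le> \<beta> / 8\<close> this forces
  \<open>\<beta> / 8 * a \<le> w\<close>.\<close>

lemma heavy_direction_y:
  assumes "\<not> 4 * \<eta>\<^sup>2 * sqn v \<le> he (snd z) (snd b)"
  shows "0 < sqn v" and "\<beta>\<^sup>2 / 64 * sqn v \<le> wsq A (snd b) v"
proof -
  define a h w where "a = sqrt (sqn v)" and "h = sqrt (he (snd z) (snd b))" and "w = sqrt (wsq A (snd b) v)"
  have "he (snd z) (snd b) < 4 * \<eta>\<^sup>2 * sqn v" using assms by simp
  then have "h < sqrt (4 * \<eta>\<^sup>2 * sqn v)" unfolding h_def by (rule real_sqrt_less_mono)
  also have "\<dots> = 2 * \<eta> * a" using \<eta> by (simp add: real_sqrt_mult a_def)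
  finally have h: "h < 2 * \<eta> * a" .
  have h0: "0 \<le> h" "h \<le> \<beta> / 8" using near_parts by (auto simp: h_def)
  have "a \<noteq> 0" using h h0 by auto
  then have a0: "0 < a" by (simp add: a_def order_less_le)
  then show "0 < sqn v" by (simp add: a_def)
  have "a\<^sup>2 = sqn v" by (simp add: a_def)
  also have "sqn v = dot v (\<lambda>j. mt A (snd z) j - mt A (snd b) j)"
    unfolding v by (rule sqn_residual(1)[OF on])
  also have "\<dots> = (\<Sum>i<m. (snd z i - snd b i) * mv A v i)"
    by (simp add: dot_diff_right left_diff_distrib sum_subtractf sum_mult_mv dot_commute)
  also have "\<dots> = (\<Sum>i<m. (sqrt (snd z i) - sqrt (snd b i)) * ((sqrt (snd z i) + sqrt (snd b i)) * mv A v i))"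
  proof (rule sum.cong, simp)
    fix i assume "i \<in> {..<m}"
    then have "snd z i - snd b i = (sqrt (snd z i))\<^sup>2 - (sqrt (snd b i))\<^sup>2" by (simp add: sqrt_pos)
    also have "\<dots> = (sqrt (snd z i) - sqrt (snd b i)) * (sqrt (snd z i) + sqrt (snd b i))"
      by (simp add: power2_eq_square algebra_simps)
    finally show "(snd z i - snd b i) * mv A v i
        = (sqrt (snd z i) - sqrt (snd b i)) * ((sqrt (snd z i) + sqrt (snd b i)) * mv A v i)"
      by (simp only: mult.assoc)
  qed
  also have "\<dots> \<le> L2_set (\<lambda>i. sqrt (snd z i) - sqrt (snd b i)) {..<m}
      * L2_set (\<lambda>i. (sqrt (snd z i) + sqrt (snd b i)) * mv A v i) {..<m}"
    by (rule sum_mult_le_L2_set)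
  also have "L2_set (\<lambda>i. sqrt (snd z i) - sqrt (snd b i)) {..<m} = h"
    by (simp add: L2_set_def h_def he_def)
  \<comment> \<open>Writing the sum of roots as their difference plus
    \<open>2 * sqrt (snd b i)\<close> separates the energy \<open>w\<close> at the center from a
    remainder of size \<open>h * a\<close>.\<close>
  also have "L2_set (\<lambda>i. (sqrt (snd z i) + sqrt (snd b i)) * mv A v i) {..<m}
      = L2_set (\<lambda>i. (sqrt (snd z i) - sqrt (snd b i)) * mv A v i + 2 * (sqrt (snd b i) * mv A v i)) {..<m}"
    by (rule L2_set_cong) (auto simp: algebra_simps)
  also have "h * \<dots> \<le> h * (h * a + 2 * w)"
  proof (rule mult_left_mono[OF order_trans[OF L2_set_triangle_ineq add_mono] h0(1)])
    show "L2_set (\<lambda>i. (sqrt (snd z i) - sqrt (snd b i)) * mv A v i) {..<m} \<le> h * a"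
      using L2_diff_mv by (simp add: h_def a_def)
    have "L2_set (\<lambda>i. 2 * (sqrt (snd b i) * mv A v i)) {..<m} = 2 * L2_set (\<lambda>i. sqrt (snd b i) * mv A v i) {..<m}"
      by (rule L2_set_right_distrib[symmetric]) simp
    then show "L2_set (\<lambda>i. 2 * (sqrt (snd b i) * mv A v i)) {..<m} \<le> 2 * w"
      by (simp add: L2_wsq w_def)
  qed
  finally have 1: "a\<^sup>2 \<le> h * (h * a + 2 * w)" .
  have w0: "0 \<le> w" unfolding w_def wsq_def
    using isplx_times[OF b] by (auto simp: splx_def intro!: sum_nonneg)
  have "h * (h * a + 2 * w) \<le> (2 * \<eta> * a) * (\<beta> / 8 * a + 2 * w)"
    using h h0 a0 w0 \<eta> by (intro mult_mono add_mono) auto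
  with 1 have "a * a \<le> a * (2 * \<eta> * (\<beta> / 8 * a + 2 * w))"
    by (simp add: power2_eq_square mult_ac)
  then have "a \<le> 2 * \<eta> * (\<beta> / 8 * a + 2 * w)" using a0 by simp
  also have "\<dots> \<le> 2 * (1 / \<beta>) * (\<beta> / 8 * a + 2 * w)"
    using \<eta> \<beta> a0 w0 by (intro mult_right_mono) auto
  also have "\<dots> = a / 4 + 4 * w / \<beta>" using \<beta> by (simp add: field_simps)
  finally have "3 / 4 * a \<le> 4 * w / \<beta>" by simp
  then have "3 / 4 * a * \<beta> \<le> 4 * w" using \<beta> by (simp add: pos_le_divide_eq)
  moreover have "0 < a * \<beta>" using a0 \<beta> by simp
  ultimately have "\<beta> / 8 * a \<le> w" by (simp add: mult.commute)
  then show "\<beta>\<^sup>2 / 64 * sqn v \<le> wsq A (snd b) v"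
    unfolding a_def w_def by (rule weight_conclude)
qed

text \<open>\<open>u\<close> is the unlearned part of the ball move and \<open>l\<close> the root of
  its energy at \<open>z\<close>. Passing to the weights at \<open>b\<close> costs at most
  \<open>h * a\<close>, hence \<open>\<beta> / 8 * a\<close>. A failed test gives
  \<open>a \<le> d < 4 * \<eta> * l\<close>, which leaves half of \<open>a\<close> to be paid by
  \<open>w\<close>.\<close>

lemma heavy_direction_x:
  assumes "\<not> 16 * \<eta>\<^sup>2 * wsq A (snd z) u \<le> sqn (\<lambda>j. fst z j - fst b j)"
  shows "0 < sqn u" and "\<beta>\<^sup>2 / 64 * sqn u \<le> wsq A (snd b) u"
proof -
  define a h w d l where "a = sqrt (sqn u)" and "h = sqrt (he (snd z) (snd b))" and "w = sqrt (wsq A (snd b) u)"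
    and "d = sqrt (sqn (\<lambda>j. fst z j - fst b j))" and "l = L2_set (\<lambda>i. sqrt (snd z i) * mv A u i) {..<m}"
  have l: "l = sqrt (wsq A (snd z) u)"
    unfolding l_def L2_set_def wsq_def by (intro arg_cong[of _ _ sqrt] sum.cong) (auto simp: power_mult_distrib sqrt_pos)
  have "sqn (\<lambda>j. fst z j - fst b j) < 16 * \<eta>\<^sup>2 * wsq A (snd z) u" using assms by simp
  then have "d < sqrt (16 * \<eta>\<^sup>2 * wsq A (snd z) u)" unfolding d_def by (rule real_sqrt_less_mono)
  also have "\<dots> = 4 * \<eta> * l" using \<eta> real_sqrt_abs[of 4] by (simp add: real_sqrt_mult l)
  finally have d: "d < 4 * \<eta> * l" .
  have h0: "0 \<le> h" "h \<le> \<beta> / 8" using near_parts by (auto simp: h_def)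
  have a0: "0 \<le> a" by (simp add: a_def)
  have w0: "0 \<le> w" unfolding w_def wsq_def
    using isplx_times[OF b] by (auto simp: splx_def intro!: sum_nonneg)
  have ad: "a \<le> d" unfolding a_def d_def u using sqn_residual_le[OF on] by (rule real_sqrt_le_mono)
  have "l = L2_set (\<lambda>i. (sqrt (snd z i) - sqrt (snd b i)) * mv A u i + sqrt (snd b i) * mv A u i) {..<m}"
    unfolding l_def by (rule L2_set_cong) (auto simp: algebra_simps)
  also have "\<dots> \<le> h * a + w"
    by (rule order_trans[OF L2_set_triangle_ineq add_mono])
      (use L2_diff_mv L2_wsq in \<open>auto simp: h_def a_def w_def\<close>)
  finally have lh: "l \<le> h * a + w" .
  have "h * a \<le> \<beta> / 8 * a" using h0 a0 by (intro mult_right_mono)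
  with lh have lb: "l \<le> \<beta> / 8 * a + w" by linarith
  have "0 < l" using d ad a0 \<eta>
    by (smt (verit) mult_nonneg_nonneg mult_nonneg_nonpos)
  show "0 < sqn u"
  proof (rule ccontr)
    assume "\<not> 0 < sqn u"
    then have "sqn u = 0" using sqn_nonneg[of u] by linarith
    then have "l \<le> 0"
      using L2_set_mv_le[OF rows, of "\<lambda>i. sqrt (snd z i)" u] by (simp add: l_def)
    then show False using \<open>0 < l\<close> by simp
  qed
  have "a \<le> 4 * \<eta> * l" using ad d by linarith
  also have "\<dots> \<le> 4 * (1 / \<beta>) * (\<beta> / 8 * a + w)"
    using lb \<eta> \<beta> \<open>0 < l\<close> by (intro mult_mono) auto
  also have "\<dots> = a / 2 + 4 * w / \<beta>" using \<beta> by (simp add: field_simps)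
  finally have "a / 2 \<le> 4 * w / \<beta>" by simp
  then have "a / 2 * \<beta> \<le> 4 * w" using \<beta> by (simp add: pos_le_divide_eq)
  then have "\<beta> / 8 * a \<le> w" by (simp add: mult.commute)
  then show "\<beta>\<^sup>2 / 64 * sqn u \<le> wsq A (snd b) u"
    unfolding a_def w_def by (rule weight_conclude)
qed

text \<open>Adding the three-point inequalities of the model step and of the correction step leaves
  the model errors \<open>v\<close> and \<open>mv A u\<close>, paired with the displacement between
  \<open>z\<close> and \<open>z'\<close>. Young's inequality and the two passed tests absorb them
  into half of the movement terms.\<close>

lemma extragradient:
  assumes step: "model_step (learned A U K) (\<lambda>j. mt A (snd b) j - mt (learned A U K) (snd b) j)
      (\<lambda>i. mv A (fst b) i - mv (learned A U K) (fst b) i) b \<eta> z"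
    and zp: "prox (\<lambda>j. \<eta> * mt A (snd z) j) (\<lambda>i. \<eta> * mv A (fst z) i) b z'"
    and crit_y: "4 * \<eta>\<^sup>2 * sqn v \<le> he (snd z) (snd b)"
    and crit_x: "16 * \<eta>\<^sup>2 * wsq A (snd z) u \<le> sqn (\<lambda>j. fst z j - fst b j)"
    and w: "w \<in> bal \<times> splx"
  shows "\<eta> * reg A z w + (V b z + V z z') / 2 \<le> V b w - V z' w"
proof -
  define gx where "gx j = mt (learned A U K) (snd z) j + (mt A (snd b) j - mt (learned A U K) (snd b) j)" for j
  define gy where "gy i = mv (learned A U K) (fst z) i + (mv A (fst b) i - mv (learned A U K) (fst b) i)" for i
  have z': "z' \<in> bal \<times> isplx" using zp by (simp add: prox_def)
  have 1: "\<eta> * lin gx gy z z' \<le> V b z' - V z z' - V b z"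
    using step isplx_times[OF z'] unfolding model_step_def prox_def mt_def[symmetric] mv_def[symmetric] lin_scale
      gx_def gy_def by blast
  have 2: "\<eta> * lin (mt A (snd z)) (mv A (fst z)) z' w \<le> V b w - V z' w - V b z'"
    using zp w unfolding prox_def lin_scale by blast
  have "reg A z w = lin (mt A (snd z)) (mv A (fst z)) z w"
    using sum_mult_mv[of "snd z" A "fst z"]
    by (simp add: reg_def lin_def right_diff_distrib sum_subtractf dot_def mult.commute)
  also have "\<dots> = lin gx gy z z' + lin (mt A (snd z)) (mv A (fst z)) z' w
      + ((\<Sum>j<n. v j * (fst z j - fst z' j)) - (\<Sum>i<m. mv A u i * (snd z i - snd z' i)))"
  proof -
    have v': "v = (\<lambda>j. mt A (snd z) j - gx j)"
      unfolding v by (intro ext) (simp add: residual_diff gx_def flip: mt_learned)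
    have u': "mv A u = (\<lambda>i. mv A (fst z) i - gy i)"
      unfolding u by (intro ext) (simp add: mv_residual gy_def mv_diff)
    show ?thesis
      unfolding u' unfolding v' lin_def by (simp add: algebra_simps sum.distrib sum_subtractf)
  qed
  finally have "\<eta> * reg A z w = \<eta> * lin gx gy z z' + \<eta> * lin (mt A (snd z)) (mv A (fst z)) z' w
      + (\<eta> * (\<Sum>j<n. v j * (fst z j - fst z' j)) - \<eta> * (\<Sum>i<m. mv A u i * (snd z i - snd z' i)))"
    by (simp only: distrib_left right_diff_distrib)
  moreover have "(\<Sum>i<m. mv A u i * (snd z i - snd z' i)) = - (\<Sum>i<m. mv A u i * (snd z' i - snd z i))"
    by (simp add: right_diff_distrib sum_subtractf)
  ultimately have 3: "\<eta> * reg A z w \<le> V b w - V z' w - V z z' - V b z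
      + (\<eta> * (\<Sum>j<n. v j * (fst z j - fst z' j)) + \<eta> * (\<Sum>i<m. mv A u i * (snd z' i - snd z i)))"
    using 1 2 by simp
  have 4: "\<eta> * (\<Sum>j<n. v j * (fst z j - fst z' j)) \<le> sqn (\<lambda>j. fst z' j - fst z j) / 4 + he (snd z) (snd b) / 4"
  proof -
    have "\<eta> * (v j * (fst z j - fst z' j)) \<le> (fst z' j - fst z j)\<^sup>2 / 4 + \<eta>\<^sup>2 * (v j)\<^sup>2" for j
      using zero_le_power2[of "(fst z' j - fst z j) / 2 + \<eta> * v j"]
      by (simp add: power2_eq_square field_simps)
    then have "\<eta> * (\<Sum>j<n. v j * (fst z j - fst z' j)) \<le> (\<Sum>j<n. (fst z' j - fst z j)\<^sup>2 / 4 + \<eta>\<^sup>2 * (v j)\<^sup>2)"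
      unfolding sum_distrib_left by (intro sum_mono)
    also have "\<dots> = sqn (\<lambda>j. fst z' j - fst z j) / 4 + \<eta>\<^sup>2 * sqn v"
      by (simp add: sum.distrib sqn_def sum_distrib_left sum_divide_distrib)
    finally show ?thesis using crit_y by linarith
  qed
  have 5: "\<eta> * (\<Sum>i<m. mv A u i * (snd z' i - snd z i)) \<le> he (snd z') (snd z) / 2 + sqn (\<lambda>j. fst z j - fst b j) / 4"
  proof -
    have "\<eta> * (mv A u i * (snd z' i - snd z i))
        \<le> (sqrt (snd z' i) - sqrt (snd z i))\<^sup>2 / 2 + 4 * \<eta>\<^sup>2 * (snd z i * (mv A u i)\<^sup>2)" if i: "i < m" for i
    proof -
      \<comment> \<open>In square-root coordinates the increment is
        \<open>2 * q * \<delta> + \<delta>\<^sup>2\<close>. The quadratic part is affordable because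
        the cap on the ball move and \<open>\<eta> \<le> 1 / \<beta>\<close> keep \<open>c\<close>
        below 1/4.\<close>
      define q \<delta> c where "q = sqrt (snd z i)" and "\<delta> = sqrt (snd z' i) - sqrt (snd z i)" and "c = \<eta> * mv A u i"
      have "\<bar>mv A u i\<bar> \<le> sqrt (sqn u)" using abs_mv_le[OF rows i] .
      also have "\<dots> \<le> \<beta> / 8"
        using near_parts(1) sqn_residual_le[OF on, of "\<lambda>j. fst z j - fst b j"] unfolding u
        by (meson order_trans real_sqrt_le_mono)
      finally have "\<bar>c\<bar> \<le> 1 / \<beta> * (\<beta> / 8)"
        unfolding c_def abs_mult using \<eta> by (intro mult_mono) auto
      then have c: "c \<le> 1 / 4" using \<beta> by simp
      have zi: "snd z i = q\<^sup>2" "snd z' i = (q + \<delta>)\<^sup>2"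
        using z z' i by (auto simp: q_def \<delta>_def isplx_def less_imp_le)
      have "c * \<delta>\<^sup>2 \<le> 1 / 4 * \<delta>\<^sup>2" using c by (intro mult_right_mono) auto
      moreover have "2 * c * \<delta> * q \<le> \<delta>\<^sup>2 / 4 + 4 * c\<^sup>2 * q\<^sup>2"
        using zero_le_power2[of "\<delta> / 2 - 2 * c * q"] by (simp add: power2_eq_square algebra_simps)
      ultimately have "c * ((q + \<delta>)\<^sup>2 - q\<^sup>2) \<le> \<delta>\<^sup>2 / 2 + 4 * c\<^sup>2 * q\<^sup>2"
        by (simp add: power2_eq_square algebra_simps)
      moreover have "\<eta> * (mv A u i * (snd z' i - snd z i)) = c * ((q + \<delta>)\<^sup>2 - q\<^sup>2)"
        by (simp only: zi c_def mult.assoc)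
      moreover have "4 * c\<^sup>2 * q\<^sup>2 = 4 * \<eta>\<^sup>2 * (snd z i * (mv A u i)\<^sup>2)"
        by (simp only: zi(1) c_def power_mult_distrib mult_ac)
      ultimately show ?thesis by (simp only: \<delta>_def)
    qed
    then have "\<eta> * (\<Sum>i<m. mv A u i * (snd z' i - snd z i))
        \<le> (\<Sum>i<m. (sqrt (snd z' i) - sqrt (snd z i))\<^sup>2 / 2 + 4 * \<eta>\<^sup>2 * (snd z i * (mv A u i)\<^sup>2))"
      unfolding sum_distrib_left by (intro sum_mono) auto
    also have "\<dots> = he (snd z') (snd z) / 2 + 4 * \<eta>\<^sup>2 * wsq A (snd z) u"
      by (simp add: sum.distrib he_def wsq_def sum_distrib_left sum_divide_distrib)
    finally show ?thesis using crit_x by linarith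
  qed
  \<comment> \<open>The errors take exactly half of this lower bound for \<open>V z z'\<close> and
    at most half of the one for \<open>V b z\<close>.\<close>
  have "sqn (\<lambda>j. fst z' j - fst z j) / 2 + he (snd z') (snd z) \<le> V z z'"
    "sqn (\<lambda>j. fst z j - fst b j) / 2 + he (snd z) (snd b) \<le> V b z"
    using V_ge[OF isplx_times[OF z'] z] V_ge[OF isplx_times[OF z] b] by auto
  moreover have "\<eta> * reg A z w \<le> V b w - V z' w - V z z' - V b z
      + (sqn (\<lambda>j. fst z' j - fst z j) / 4 + he (snd z) (snd b) / 4
        + (he (snd z') (snd z) / 2 + sqn (\<lambda>j. fst z j - fst b j) / 4))"
    by (rule order_trans[OF 3 add_left_mono[OF add_mono[OF 4 5]]])
  ultimately show ?thesis using he_nonneg[of "snd z" "snd b"] by argo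
qed

end

end

section \<open>Dyadic regularization\<close>

lemma telescope_multiples:
  fixes v :: "nat \<Rightarrow> real"
  assumes "0 < d"
  shows "(\<Sum>s\<in>{s\<in>{1..t}. d dvd s}. v (s - d) - v s) = v 0 - v (t - t mod d)"
proof (induction t)
  case 0
  have "{s\<in>{1..0::nat}. d dvd s} = {}" by auto
  then show ?case by simp
next
  case (Suc t)
  show ?case
  proof (cases "d dvd Suc t")
    case True
    then have "{s\<in>{1..Suc t}. d dvd s} = insert (Suc t) {s\<in>{1..t}. d dvd s}"
      by (auto simp: le_Suc_eq)
    \<comment> \<open>The predecessor of the new multiple is the last multiple counted so
      far.\<close>
    moreover have "Suc t - d = t - t mod d"
    proof -
      have "t mod d = d - 1"
        using True assms by (metis Suc_pred' diff_Suc_1 dvd_imp_mod_0 mod_Suc nat.distinct(1))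
      then show ?thesis using assms by simp
    qed
    moreover have "Suc t mod d = 0" using True by simp
    ultimately show ?thesis using Suc.IH by simp
  next
    case False
    then have "{s\<in>{1..Suc t}. d dvd s} = {s\<in>{1..t}. d dvd s}"
      by (auto simp: le_Suc_eq)
    moreover have "Suc t - Suc t mod d = t - t mod d"
      using False by (metis dvd_eq_mod_eq_0 mod_Suc diff_Suc_Suc)
    ultimately show ?thesis using Suc.IH by simp
  qed
qed

text \<open>Level \<open>j\<close> is active at step \<open>s\<close> when \<open>s\<close> lies on
  its grid; the predecessor of \<open>s\<close> there is \<open>s - 2 ^ j\<close>.\<close>

definition lvl :: "nat \<Rightarrow> nat \<Rightarrow> nat set" where
  "lvl J s = {j. j < J \<and> 2 ^ j dvd s}"

lemma finite_lvl [simp]: "finite (lvl J s)"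
  by (simp add: lvl_def)

lemma zero_in_lvl: "0 < J \<Longrightarrow> 0 \<in> lvl J s"
  by (simp add: lvl_def)

lemma sum_lvl_swap:
  fixes f :: "nat \<Rightarrow> nat \<Rightarrow> real"
  shows "(\<Sum>s=1..t. \<Sum>j\<in>lvl J s. f j s) = (\<Sum>j<J. \<Sum>s\<in>{s\<in>{1..t}. 2 ^ j dvd s}. f j s)"
proof -
  have l: "lvl J s = {j\<in>{..<J}. 2 ^ j dvd s}" for s by (auto simp: lvl_def)
  show ?thesis unfolding l by (rule sum.swap_restrict) auto
qed

text \<open>Each level telescopes along its own grid and contributes at most \<open>v 0\<close>,
  whence the factor \<open>J\<close>.\<close>

lemma telescope_lvl:
  fixes v :: "nat \<Rightarrow> real"
  assumes "\<And>s. s \<le> t \<Longrightarrow> 0 \<le> v s"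
  shows "(\<Sum>s=1..t. \<Sum>j\<in>lvl J s. v (s - 2 ^ j) - v s) \<le> real J * v 0"
proof -
  have "(\<Sum>s=1..t. \<Sum>j\<in>lvl J s. v (s - 2 ^ j) - v s)
      = (\<Sum>j<J. v 0 - v (t - t mod 2 ^ j))"
    unfolding sum_lvl_swap by (intro sum.cong refl telescope_multiples) simp
  also have "\<dots> \<le> (\<Sum>j<J. v 0)" using assms by (intro sum_mono) auto
  finally show ?thesis by simp
qed

text \<open>Following the binary expansion, every index is reached from 0 by one dyadic jump per level.\<close>

lemma dyadic_chain:
  fixes q :: "nat \<Rightarrow> real"
  assumes S: "\<And>j. S j = (\<Sum>s\<in>{s\<in>{1..t}. 2 ^ j dvd s}. (q s - q (s - 2 ^ j))\<^sup>2)"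
    and "r < 2 ^ J" "2 ^ J dvd a" "a + r \<le> t"
  shows "\<bar>q (a + r) - q a\<bar> \<le> (\<Sum>j<J. sqrt (S j))"
  using assms(2-)
proof (induction J arbitrary: a r)
  case 0
  then show ?case by simp
next
  case (Suc J)
  have d: "2 ^ J dvd a" using Suc.prems(2) by (rule dvd_trans[rotated]) simp
  have S0: "0 \<le> S J" unfolding S by (simp add: sum_nonneg)
  show ?case
  proof (cases "r < 2 ^ J")
    case True
    then show ?thesis
      using Suc.IH[OF True d Suc.prems(3)] real_sqrt_ge_zero[OF S0] unfolding sum.lessThan_Suc by linarith
  next
    case False
    \<comment> \<open>The highest bit of the offset is jumped first; \<open>b\<close> is again a
      multiple of \<open>2 ^ J\<close>, as the induction hypothesis requires.\<close>
    define b where "b = a + 2 ^ J"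
    have br: "b + (r - 2 ^ J) = a + r" using False by (simp add: b_def)
    have "\<bar>q (b + (r - 2 ^ J)) - q b\<bar> \<le> (\<Sum>j<J. sqrt (S j))"
      using Suc.prems d False by (intro Suc.IH) (auto simp: b_def)
    moreover have "\<bar>q b - q a\<bar> \<le> sqrt (S J)"
    proof -
      have "b \<in> {s\<in>{1..t}. 2 ^ J dvd s}"
        using Suc.prems d False by (auto simp: b_def)
      then have "(q b - q (b - 2 ^ J))\<^sup>2 \<le> S J"
        unfolding S by (intro member_le_sum) auto
      then have "(q b - q a)\<^sup>2 \<le> S J" by (simp add: b_def)
      then show ?thesis by (metis real_sqrt_abs real_sqrt_le_mono)
    qed
    ultimately show ?thesis by (simp add: br)
  qed
qed

lemma sum_sqrt_sq_le:
  fixes S :: "nat \<Rightarrow> real"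
  assumes "\<And>j. 0 \<le> S j"
  shows "(\<Sum>j<J. sqrt (S j))\<^sup>2 \<le> real J * (\<Sum>j<J. S j)"
proof -
  have "(\<Sum>j<J. sqrt (S j) * 1) \<le> L2_set (\<lambda>j. sqrt (S j)) {..<J} * L2_set (\<lambda>_. 1) {..<J}"
    by (rule sum_mult_le_L2_set)
  also have "\<dots> = sqrt (real J * (\<Sum>j<J. S j))"
    using assms by (simp add: L2_set_def real_sqrt_mult)
  finally show ?thesis using assms by (intro sqrt_ge_absD) (simp add: sum_nonneg)
qed

lemma sq_sum3_le: "(x + y + z)\<^sup>2 \<le> 3 * (x\<^sup>2 + y\<^sup>2 + z\<^sup>2)" for x y z :: real
  using zero_le_power2[of "x - y"] zero_le_power2[of "y - z"] zero_le_power2[of "x - z"]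
  by (simp add: power2_eq_square algebra_simps)

section \<open>Regret, movement and counting along a multipoint run\<close>

context simplex_ball
begin

lemma he_triangle3: "he a d \<le> 3 * (he a b + he b c + he c d)"
  unfolding he_def sum.distrib[symmetric] sum_distrib_left
proof (intro sum_mono)
  fix i
  show "(sqrt (a i) - sqrt (d i))\<^sup>2
      \<le> 3 * ((sqrt (a i) - sqrt (b i))\<^sup>2 + (sqrt (b i) - sqrt (c i))\<^sup>2 + (sqrt (c i) - sqrt (d i))\<^sup>2)"
    using sq_sum3_le[of "sqrt (a i) - sqrt (b i)" "sqrt (b i) - sqrt (c i)" "sqrt (c i) - sqrt (d i)"] by simp
qed

lemma he_le_V:
  assumes "u \<in> bal \<times> isplx" "b \<in> bal \<times> isplx"
  shows "he (snd u) (snd b) \<le> V b u"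
  using V_ge[OF isplx_times[OF assms(1)] assms(2)] sqn_nonneg[of "\<lambda>j. fst u j - fst b j"] by linarith

definition start :: "(nat \<Rightarrow> real) \<times> (nat \<Rightarrow> real)" where
  "start = (\<lambda>_. 0, \<lambda>_. 1 / real m)"

lemma start_mem: "start \<in> bal \<times> isplx"
  using m_pos by (simp add: start_def bal_def isplx_def sqn_def)

lemma V_start_le:
  assumes "u \<in> bal \<times> splx"
  shows "V start u \<le> 1 / 2 + ln (real m)"
proof -
  have "KL (snd u) (snd start) \<le> (\<Sum>i<m. snd u i * ln (real m))"
    unfolding KL_def
  proof (intro sum_mono mult_left_mono)
    fix i assume i: "i \<in> {..<m}"
    have "0 \<le> snd u i" "snd u i \<le> 1"
      using assms i abs_le_one_splx[of "snd u" i] by (auto simp: splx_def)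
    then show "0 \<le> snd u i" by simp
    have "ln (snd u i) \<le> 0"
    \<comment> \<open>The boundary case rests on the convention \<open>ln 0 = 0\<close>.\<close>
    proof (cases "snd u i = 0")
      case True then show ?thesis by simp
    next
      case False
      then show ?thesis using \<open>0 \<le> snd u i\<close> \<open>snd u i \<le> 1\<close> by simp
    qed
    then show "ln (snd u i) - ln (snd start i) \<le> ln (real m)"
      using m_pos by (simp add: start_def ln_div)
  qed
  also have "\<dots> = ln (real m)" using assms by (auto simp: splx_def simp flip: sum_distrib_right)
  finally show ?thesis using assms by (auto simp: V_def start_def bal_def)
qed

definition center :: "nat \<Rightarrow> (nat \<Rightarrow> (nat \<Rightarrow> real) \<times> (nat \<Rightarrow> real)) \<Rightarrow> nat \<Rightarrow> (nat \<Rightarrow> real) \<times> (nat \<Rightarrow> real)" where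
  "center J Z s = bary (lvl J s) (\<lambda>j. Z (s - 2 ^ j))"

end

text \<open>The record of \<open>t\<close> completed steps: iterates \<open>Z\<close>, model points
  \<open>Zh\<close> to be averaged, and step sizes \<open>\<eta>\<close>. The assumption
  \<open>step\<close> is the conclusion of \<open>extragradient\<close> for each completed step, and
  \<open>t < 2 ^ J\<close> lets \<open>J\<close> levels reach every index.\<close>

locale multipoint_run = simplex_ball +
  fixes J t :: nat and A :: "nat \<Rightarrow> nat \<Rightarrow> real" and Z Zh :: "nat \<Rightarrow> (nat \<Rightarrow> real) \<times> (nat \<Rightarrow> real)"
    and \<eta> :: "nat \<Rightarrow> real" and \<beta> :: real
  assumes J_pos: "0 < J" and t_less: "t < 2 ^ J" and \<beta>_pos: "0 < \<beta>"
    and Z_0: "Z 0 = start"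
    and Z_mem: "s \<le> t \<Longrightarrow> Z s \<in> bal \<times> isplx"
    and Zh_mem: "1 \<le> s \<Longrightarrow> s \<le> t \<Longrightarrow> Zh s \<in> bal \<times> isplx"
    and \<eta>_nonneg: "1 \<le> s \<Longrightarrow> s \<le> t \<Longrightarrow> 0 \<le> \<eta> s"
    and full_step: "1 \<le> s \<Longrightarrow> s \<le> t \<Longrightarrow> \<eta> s = 1 / \<beta> \<or> dst (Zh s) (center J Z s) = \<beta> / 8"
    and step: "1 \<le> s \<Longrightarrow> s \<le> t \<Longrightarrow> u \<in> bal \<times> splx \<Longrightarrow>
      \<eta> s * reg A (Zh s) u + (V (center J Z s) (Zh s) + V (Zh s) (Z s)) / 2
        \<le> V (center J Z s) u - V (Z s) u"
begin

text \<open>Multiplying a step by its number of active levels turns the divergence from its center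
  into the sum over the levels, up to a constant; so this is the weight of the step in the
  average.\<close>

definition h :: "nat \<Rightarrow> real" where
  "h s = real (card (lvl J s)) * \<eta> s"

text \<open>Movement that survives in the regret inequality: from the predecessors to their
  barycenter and, with factor 1/2 per level, on to \<open>Zh s\<close> and
  \<open>Z s\<close>.\<close>

definition ret :: "nat \<Rightarrow> real" where
  "ret s = (\<Sum>j\<in>lvl J s. V (Z (s - 2 ^ j)) (center J Z s))
     + real (card (lvl J s)) / 2 * (V (center J Z s) (Zh s) + V (Zh s) (Z s))"

lemma card_lvl_ge: "1 \<le> real (card (lvl J s))"
  using zero_in_lvl[OF J_pos, of s] by (metis One_nat_def Suc_leI card_gt_0_iff empty_iff finite_lvl of_nat_1 of_nat_le_iff)

lemma center:
  assumes "1 \<le> s" "s \<le> Suc t"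
  shows center_mem: "center J Z s \<in> bal \<times> isplx"
    and center_split: "u \<in> bal \<times> splx \<Longrightarrow> (\<Sum>j\<in>lvl J s. V (Z (s - 2 ^ j)) u)
      = card (lvl J s) * V (center J Z s) u + (\<Sum>j\<in>lvl J s. V (Z (s - 2 ^ j)) (center J Z s))"
proof -
  have ne: "lvl J s \<noteq> {}" using zero_in_lvl[OF J_pos] by auto
  moreover have mem: "Z (s - 2 ^ j) \<in> bal \<times> isplx" for j
  proof (rule Z_mem)
    \<comment> \<open>Every jump has length at least 1, so even the center of the pending step
      \<open>Suc t\<close> sees only indices up to \<open>t\<close>.\<close>
    have "(1::nat) \<le> 2 ^ j" by simp
    then show "s - 2 ^ j \<le> t" using assms by arith
  qed
  ultimately show "center J Z s \<in> bal \<times> isplx"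
    unfolding center_def by (intro bary_mem finite_lvl)
  show "(\<Sum>j\<in>lvl J s. V (Z (s - 2 ^ j)) u)
      = card (lvl J s) * V (center J Z s) u + (\<Sum>j\<in>lvl J s. V (Z (s - 2 ^ j)) (center J Z s))"
    if "u \<in> bal \<times> splx"
    unfolding center_def by (rule bary_split[OF finite_lvl ne mem that])
qed

lemma weighted_step:
  assumes s: "1 \<le> s" "s \<le> t" and u: "u \<in> bal \<times> splx"
  shows "h s * reg A (Zh s) u + ret s \<le> (\<Sum>j\<in>lvl J s. V (Z (s - 2 ^ j)) u - V (Z s) u)"
proof -
  have "real (card (lvl J s)) * (\<eta> s * reg A (Zh s) u + (V (center J Z s) (Zh s) + V (Zh s) (Z s)) / 2)
      \<le> real (card (lvl J s)) * (V (center J Z s) u - V (Z s) u)"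
    using step[OF s u] by (intro mult_left_mono) auto
  then show ?thesis
    using center_split[of s u] s u by (simp add: h_def ret_def sum_subtractf algebra_simps add_divide_distrib)
qed

lemma regret_le:
  assumes u: "u \<in> bal \<times> splx"
  shows "(\<Sum>s=1..t. h s * reg A (Zh s) u) + (\<Sum>s=1..t. ret s) \<le> real J * (1 / 2 + ln (real m))"
proof -
  have "(\<Sum>s=1..t. h s * reg A (Zh s) u) + (\<Sum>s=1..t. ret s)
      \<le> (\<Sum>s=1..t. \<Sum>j\<in>lvl J s. V (Z (s - 2 ^ j)) u - V (Z s) u)"
    unfolding sum.distrib[symmetric] using u by (intro sum_mono weighted_step) auto
  also have "\<dots> \<le> real J * V (Z 0) u"
    using u Z_mem by (intro telescope_lvl V_nonneg) auto
  also have "\<dots> \<le> real J * (1 / 2 + ln (real m))"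
    using V_start_le[OF u] by (simp add: Z_0 mult_left_mono)
  finally show ?thesis .
qed

definition H :: real where "H = (\<Sum>s=1..t. h s)"

definition avg :: "(nat \<Rightarrow> real) \<times> (nat \<Rightarrow> real)" where
  "avg = (\<lambda>j. \<Sum>s=1..t. h s / H * fst (Zh s) j, \<lambda>i. \<Sum>s=1..t. h s / H * snd (Zh s) i)"

lemma h_nonneg: "s \<in> {1..t} \<Longrightarrow> 0 \<le> h s"
  using \<eta>_nonneg by (simp add: h_def)

lemma avg_mem:
  assumes "0 < H"
  shows "avg \<in> bal \<times> splx"
proof -
  have 1: "(\<Sum>s=1..t. h s / H) = 1" using assms by (simp add: H_def flip: sum_divide_distrib)
  have 2: "fst (Zh s) \<in> bal" "snd (Zh s) \<in> splx" if "s \<in> {1..t}" for s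
    using Zh_mem[of s] that isplx_subset by auto
  show ?thesis
    unfolding avg_def by (intro SigmaI bal_average splx_average) (use 1 2 assms h_nonneg in auto)
qed

lemma reg_avg:
  assumes "0 < H"
  shows "H * reg A avg u = (\<Sum>s=1..t. h s * reg A (Zh s) u)"
proof -
  have "mv A (fst avg) i = (\<Sum>s=1..t. h s / H * mv A (fst (Zh s)) i)" for i
    by (simp only: avg_def fst_conv mv_eq_dot dot_sum_right)
  moreover have "dot (mt A (snd avg)) (fst u) = (\<Sum>s=1..t. h s / H * dot (mt A (snd (Zh s))) (fst u))"
  proof -
    have "dot (mt A (snd avg)) (fst u) = (\<Sum>i<m. \<Sum>s=1..t. h s / H * (snd (Zh s) i * mv A (fst u) i))"
      by (simp add: avg_def sum_distrib_right mult.assoc flip: sum_mult_mv)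
    also have "\<dots> = (\<Sum>s=1..t. h s / H * dot (mt A (snd (Zh s))) (fst u))"
      by (subst sum.swap) (simp add: sum_mult_mv[symmetric] sum_distrib_left)
    finally show ?thesis .
  qed
  moreover have "(\<Sum>i<m. (\<Sum>s=1..t. h s / H * mv A (fst (Zh s)) i) * snd u i)
      = (\<Sum>s=1..t. h s / H * (\<Sum>i<m. mv A (fst (Zh s)) i * snd u i))"
    unfolding sum_distrib_right by (subst sum.swap) (simp add: sum_distrib_left mult.assoc)
  ultimately have "reg A avg u = (\<Sum>s=1..t. h s / H * reg A (Zh s) u)"
    by (simp add: reg_def right_diff_distrib sum_subtractf)
  also have "H * \<dots> = (\<Sum>s=1..t. h s * reg A (Zh s) u)"
    using assms by (simp add: sum_distrib_left)
  finally show ?thesis .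
qed

lemma reg_self: "reg A z z = 0"
  using sum_mult_mv[of "snd z" A "fst z"] by (simp add: reg_def mult.commute)

lemma ret_nonneg:
  assumes "s \<in> {1..t}"
  shows "0 \<le> ret s"
proof -
  have "Z (s - 2 ^ j) \<in> bal \<times> isplx" for j by (rule Z_mem) (use assms in auto)
  then show ?thesis
    unfolding ret_def using assms center_mem[of s] Zh_mem[of s] Z_mem[of s]
    by (intro add_nonneg_nonneg sum_nonneg mult_nonneg_nonneg V_nonneg) (auto intro: isplx_times simp del: mem_Sigma_iff)
qed

text \<open>Evaluating the regret at the average iterate, where it vanishes by skew symmetry, bounds the
  total movement on all dyadic scales without reference to an equilibrium.\<close>

lemma sum_ret_le: "(\<Sum>s=1..t. ret s) \<le> real J * (1 / 2 + ln (real m))"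
proof (cases "0 < H")
  case True
  then show ?thesis
    using regret_le[OF avg_mem[OF True]] reg_avg[OF True, of avg] by (simp add: reg_self)
next
  \<comment> \<open>Without any weight the regret terms vanish for every comparator, so
    \<open>start\<close> serves.\<close>
  case False
  have "0 \<le> H" unfolding H_def using h_nonneg by (intro sum_nonneg) auto
  with False have "H = 0" by simp
  then have "\<forall>s\<in>{1..t}. h s = 0"
    unfolding H_def using h_nonneg by (subst (asm) sum_nonneg_eq_0_iff) auto
  then show ?thesis
    using regret_le[OF isplx_times[OF start_mem]] by simp
qed

text \<open>A dyadic jump passes from the predecessor through the center and \<open>Zh s\<close> to
  \<open>Z s\<close>, which costs a factor 3 for squared distances; a further factor 2 undoes the
  halving in \<open>ret\<close>.\<close>

lemma he_levels_le_ret: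
  assumes s: "s \<in> {1..t}"
  shows "(\<Sum>j\<in>lvl J s. he (snd (Z s)) (snd (Z (s - 2 ^ j)))) \<le> 6 * ret s"
    and "he (snd (center J Z s)) (snd (Z (s - 1))) \<le> ret s"
proof -
  have m: "Z (s - 2 ^ j) \<in> bal \<times> isplx" "Z s \<in> bal \<times> isplx" "Zh s \<in> bal \<times> isplx" "center J Z s \<in> bal \<times> isplx" for j
    using s by (auto intro!: Z_mem Zh_mem center_mem simp del: mem_Sigma_iff)
  have "(\<Sum>j\<in>lvl J s. he (snd (Z s)) (snd (Z (s - 2 ^ j))))
      \<le> (\<Sum>j\<in>lvl J s. 3 * (V (Zh s) (Z s) + V (center J Z s) (Zh s) + V (Z (s - 2 ^ j)) (center J Z s)))"
  proof (intro sum_mono)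
    fix j
    have "he (snd (Z s)) (snd (Zh s)) \<le> V (Zh s) (Z s)"
      "he (snd (Zh s)) (snd (center J Z s)) \<le> V (center J Z s) (Zh s)"
      "he (snd (center J Z s)) (snd (Z (s - 2 ^ j))) \<le> V (Z (s - 2 ^ j)) (center J Z s)"
      using m by (auto intro!: he_le_V simp del: mem_Sigma_iff)
    then show "he (snd (Z s)) (snd (Z (s - 2 ^ j)))
        \<le> 3 * (V (Zh s) (Z s) + V (center J Z s) (Zh s) + V (Z (s - 2 ^ j)) (center J Z s))"
      by (intro order_trans[OF he_triangle3[of "snd (Z s)" _ "snd (Zh s)" "snd (center J Z s)"] mult_left_mono] add_mono) auto
  qed
  also have "\<dots> = 3 * (real (card (lvl J s)) * (V (center J Z s) (Zh s) + V (Zh s) (Z s))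
      + (\<Sum>j\<in>lvl J s. V (Z (s - 2 ^ j)) (center J Z s)))"
    by (simp add: sum.distrib sum_distrib_left algebra_simps)
  also have "\<dots> \<le> 6 * ret s"
  proof -
    have "0 \<le> (\<Sum>j\<in>lvl J s. V (Z (s - 2 ^ j)) (center J Z s))"
      using m by (intro sum_nonneg V_nonneg) (auto intro: isplx_times simp del: mem_Sigma_iff)
    then show ?thesis unfolding ret_def by argo
  qed
  finally show "(\<Sum>j\<in>lvl J s. he (snd (Z s)) (snd (Z (s - 2 ^ j)))) \<le> 6 * ret s" .
  have "he (snd (center J Z s)) (snd (Z (s - 1))) \<le> V (Z (s - 2 ^ 0)) (center J Z s)"
    using he_le_V[OF m(4) m(1)[of 0]] by simp
  also have "\<dots> \<le> (\<Sum>j\<in>lvl J s. V (Z (s - 2 ^ j)) (center J Z s))"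
    using m by (intro member_le_sum zero_in_lvl J_pos V_nonneg) (auto intro: isplx_times simp del: mem_Sigma_iff)
  also have "\<dots> \<le> ret s"
  proof -
    have "0 \<le> real (card (lvl J s)) / 2 * (V (center J Z s) (Zh s) + V (Zh s) (Z s))"
      using m by (intro mult_nonneg_nonneg add_nonneg_nonneg V_nonneg) (auto intro: isplx_times simp del: mem_Sigma_iff)
    then show ?thesis unfolding ret_def by linarith
  qed
  finally show "he (snd (center J Z s)) (snd (Z (s - 1))) \<le> ret s" .
qed

text \<open>In square-root coordinates a center entry is reached from \<open>start\<close> by at
  most one jump per level and one final move to the center. Each of these is bounded by a sum of
  squares independent of \<open>s\<close>. Squaring and summing over \<open>i\<close> leaves the
  total Hellinger movement, which \<open>sum_ret_le\<close> controls.\<close>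

lemma envelope:
  "\<exists>W. (\<forall>s\<in>{1..Suc t}. \<forall>i<m. snd (center J Z s) i \<le> W i) \<and>
    (\<Sum>i<m. W i) \<le> 4 + 21 * (real J)\<^sup>2 * (1 / 2 + ln (real m))"
proof -
  define D where "D = 1 / 2 + ln (real m)"
  have D: "0 \<le> D" using m_pos by (simp add: D_def)
  define q where "q i s = sqrt (snd (Z s) i)" for i s
  define S where "S i j = (\<Sum>s\<in>{s\<in>{1..t}. 2 ^ j dvd s}. (q i s - q i (s - 2 ^ j))\<^sup>2)" for i j
  define SB where "SB i = (\<Sum>s=1..t. (sqrt (snd (center J Z s) i) - q i (s - 1))\<^sup>2)" for i
  \<comment> \<open>The center of the pending step is added separately, since no completed step
    controls the move to it; it adds 1 to the total.\<close>
  define W where "W i = 3 * ((q i 0)\<^sup>2 + real J * (\<Sum>j<J. S i j) + SB i) + snd (center J Z (Suc t)) i" for i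
  have S0: "0 \<le> S i j" "0 \<le> SB i" for i j by (simp_all add: S_def SB_def sum_nonneg)
  have cm: "0 < snd (center J Z s) i" if "s \<in> {1..Suc t}" "i < m" for s i
    using center_mem[of s] that by (auto simp: isplx_def mem_Times_iff)
  have "snd (center J Z s) i \<le> W i" if s: "s \<in> {1..Suc t}" and i: "i < m" for s i
  proof (cases "s = Suc t")
    case True
    have "0 \<le> 3 * ((q i 0)\<^sup>2 + real J * (\<Sum>j<J. S i j) + SB i)"
      using S0 by (intro mult_nonneg_nonneg add_nonneg_nonneg sum_nonneg) auto
    then show ?thesis by (simp add: W_def True)
  next
    case False
    then have st: "s \<in> {1..t}" using s by auto
    have "\<bar>q i (0 + (s - 1)) - q i 0\<bar> \<le> (\<Sum>j<J. sqrt (S i j))"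
      by (rule dyadic_chain[OF S_def]) (use st t_less in auto)
    then have 1: "q i (s - 1) \<le> q i 0 + (\<Sum>j<J. sqrt (S i j))" by simp
    have "(sqrt (snd (center J Z s) i) - q i (s - 1))\<^sup>2 \<le> SB i"
      unfolding SB_def using st by (intro member_le_sum) auto
    then have "\<bar>sqrt (snd (center J Z s) i) - q i (s - 1)\<bar> \<le> sqrt (SB i)"
      by (metis real_sqrt_abs real_sqrt_le_mono)
    with 1 have "sqrt (snd (center J Z s) i) \<le> q i 0 + (\<Sum>j<J. sqrt (S i j)) + sqrt (SB i)" by linarith
    then have "(sqrt (snd (center J Z s) i))\<^sup>2 \<le> (q i 0 + (\<Sum>j<J. sqrt (S i j)) + sqrt (SB i))\<^sup>2"
      using cm[OF s i] by (intro power_mono) auto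
    also have "\<dots> \<le> 3 * ((q i 0)\<^sup>2 + (\<Sum>j<J. sqrt (S i j))\<^sup>2 + (sqrt (SB i))\<^sup>2)" by (rule sq_sum3_le)
    also have "\<dots> \<le> 3 * ((q i 0)\<^sup>2 + real J * (\<Sum>j<J. S i j) + SB i)"
      using sum_sqrt_sq_le[of "S i" J] S0 by simp
    finally have "(sqrt (snd (center J Z s) i))\<^sup>2 \<le> 3 * ((q i 0)\<^sup>2 + real J * (\<Sum>j<J. S i j) + SB i)" .
    moreover have "0 < snd (center J Z (Suc t)) i" using cm i by simp
    ultimately show ?thesis using cm[OF s i] by (simp add: W_def)
  qed
  moreover have "(\<Sum>i<m. W i) \<le> 4 + 21 * (real J)\<^sup>2 * D"
  proof -
    have "(\<Sum>i<m. \<Sum>j<J. S i j) = (\<Sum>j<J. \<Sum>i<m. S i j)" by (rule sum.swap)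
    also have "\<dots> = (\<Sum>j<J. \<Sum>s\<in>{s\<in>{1..t}. 2 ^ j dvd s}. he (snd (Z s)) (snd (Z (s - 2 ^ j))))"
      unfolding S_def he_def q_def by (subst sum.swap) simp
    also have "\<dots> = (\<Sum>s=1..t. \<Sum>j\<in>lvl J s. he (snd (Z s)) (snd (Z (s - 2 ^ j))))"
      by (rule sum_lvl_swap[symmetric])
    also have "\<dots> \<le> (\<Sum>s=1..t. 6 * ret s)" by (intro sum_mono he_levels_le_ret)
    also have "\<dots> \<le> 6 * (real J * D)" using sum_ret_le by (simp add: D_def flip: sum_distrib_left)
    finally have 1: "(\<Sum>i<m. \<Sum>j<J. S i j) \<le> 6 * (real J * D)" .
    have "(\<Sum>i<m. SB i) = (\<Sum>s=1..t. he (snd (center J Z s)) (snd (Z (s - 1))))"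
      unfolding SB_def he_def q_def by (rule sum.swap)
    also have "\<dots> \<le> (\<Sum>s=1..t. ret s)" by (intro sum_mono he_levels_le_ret)
    finally have 2: "(\<Sum>i<m. SB i) \<le> real J * D" using sum_ret_le by (simp add: D_def)
    have 3: "(\<Sum>i<m. (q i 0)\<^sup>2) = 1"
      using m_pos by (simp add: q_def Z_0 start_def)
    have 4: "(\<Sum>i<m. snd (center J Z (Suc t)) i) = 1"
      using center_mem[of "Suc t"] by (auto simp: isplx_def mem_Times_iff)
    have "(\<Sum>i<m. W i) = 3 * ((\<Sum>i<m. (q i 0)\<^sup>2) + real J * (\<Sum>i<m. \<Sum>j<J. S i j) + (\<Sum>i<m. SB i))
        + (\<Sum>i<m. snd (center J Z (Suc t)) i)"
      by (simp add: W_def sum.distrib sum_distrib_left)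
    also have "\<dots> \<le> 3 * (1 + real J * (6 * (real J * D)) + real J * D) + 1"
      unfolding 3 4 using 1 2 by (intro add_mono mult_left_mono) auto
    \<comment> \<open>By \<open>J \<ge> 1\<close> the constants become \<open>4 = 3 + 1\<close> and
      \<open>21 = 3 * (6 + 1)\<close>.\<close>
    also have "\<dots> \<le> 4 + 21 * ((real J)\<^sup>2 * D)"
    proof -
      have "real J * D \<le> (real J)\<^sup>2 * D"
        using J_pos D by (intro mult_right_mono) (auto simp: power2_eq_square)
      then have "3 * (1 + 6 * ((real J)\<^sup>2 * D) + real J * D) + 1
          \<le> 3 * (1 + 6 * ((real J)\<^sup>2 * D) + (real J)\<^sup>2 * D) + 1"
        by (intro add_mono mult_left_mono) auto
      then show ?thesis by (simp add: power2_eq_square mult.left_commute)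
    qed
    finally show ?thesis by (simp only: mult.assoc)
  qed
  ultimately show ?thesis unfolding D_def by blast
qed

text \<open>The directions may be heavy at different centers; the envelope replaces all these
  weights by one \<open>W\<close>. The energies of the orthonormal directions then add up row by
  row, and Bessel's inequality with row norms at most 1 bounds the total by the sum of
  \<open>W\<close>.\<close>

lemma count_heavy_directions:
  assumes rows: "rows_le_one A" and on: "orthonormal U K"
    and heavy: "\<And>k. k < K \<Longrightarrow> \<exists>s\<in>{1..Suc t}. \<beta>\<^sup>2 / 64 \<le> wsq A (snd (center J Z s)) (U k)"
  shows "real K * \<beta>\<^sup>2 / 64 \<le> 4 + 21 * (real J)\<^sup>2 * (1 / 2 + ln (real m))"
proof -
  obtain W where W': "\<forall>s\<in>{1..Suc t}. \<forall>i<m. snd (center J Z s) i \<le> W i"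
    and sumW: "(\<Sum>i<m. W i) \<le> 4 + 21 * (real J)\<^sup>2 * (1 / 2 + ln (real m))"
    using envelope by blast
  have W: "snd (center J Z s) i \<le> W i" if "s \<in> {1..Suc t}" "i < m" for s i
    using W' that by blast
  have W0: "0 \<le> W i" if "i < m" for i
    using W[of "Suc t" i] center_mem[of "Suc t"] that by (force simp: isplx_def mem_Times_iff)
  have "(\<Sum>k<K. \<beta>\<^sup>2 / 64) \<le> (\<Sum>k<K. \<Sum>i<m. W i * (mv A (U k) i)\<^sup>2)"
  proof (intro sum_mono)
    fix k assume "k \<in> {..<K}"
    then obtain s where s: "s \<in> {1..Suc t}" and "\<beta>\<^sup>2 / 64 \<le> wsq A (snd (center J Z s)) (U k)"
      using heavy[of k] by blast
    note this(2)
    also have "wsq A (snd (center J Z s)) (U k) \<le> (\<Sum>i<m. W i * (mv A (U k) i)\<^sup>2)"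
      unfolding wsq_def using W[OF s] by (intro sum_mono mult_right_mono) auto
    finally show "\<beta>\<^sup>2 / 64 \<le> (\<Sum>i<m. W i * (mv A (U k) i)\<^sup>2)" .
  qed
  also have "\<dots> = (\<Sum>i<m. W i * (\<Sum>k<K. (dot (U k) (A i))\<^sup>2))"
    by (subst sum.swap) (simp add: sum_distrib_left mv_eq_dot dot_commute)
  also have "\<dots> \<le> (\<Sum>i<m. W i * 1)"
    using rows W0 bessel[OF on] by (intro sum_mono mult_left_mono) (auto simp: rows_le_one_def intro: order_trans)
  finally show ?thesis using sumW by simp
qed

text \<open>A capped step retains movement at least \<open>\<beta>\<^sup>2 / 256\<close>, so at most
  \<open>256 * D / \<beta>\<^sup>2\<close> steps are capped. At least
  \<open>D / \<beta>\<^sup>2\<close> full steps remain, each of weight at least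
  \<open>1 / \<beta>\<close>.\<close>

lemma total_weight_ge:
  assumes "real t \<ge> 257 * (real J * (1 / 2 + ln (real m))) / \<beta>\<^sup>2"
  shows "real J * (1 / 2 + ln (real m)) / \<beta> ^ 3 \<le> H"
proof -
  define D where "D = real J * (1 / 2 + ln (real m))"
  define G where "G = {s\<in>{1..t}. \<eta> s = 1 / \<beta>}"
  have fin: "finite G" "G \<subseteq> {1..t}" by (auto simp: G_def)
  have "(\<Sum>s\<in>{1..t} - G. \<beta>\<^sup>2 / 256) \<le> (\<Sum>s\<in>{1..t} - G. ret s)"
  proof (intro sum_mono)
    fix s assume s: "s \<in> {1..t} - G"
    then have s': "1 \<le> s" "s \<le> t" by auto
    have d: "dst (Zh s) (center J Z s) = \<beta> / 8" using full_step[of s] s by (auto simp: G_def)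
    have "(\<beta> / 8)\<^sup>2 \<le> 2 * V (center J Z s) (Zh s)"
      using dst_sq_le_V[OF isplx_times[OF Zh_mem[OF s']] center_mem[of s]] s' by (simp only: d le_SucI)
    then have 1: "\<beta>\<^sup>2 / 128 \<le> V (center J Z s) (Zh s)" by (simp add: power_divide)
    have "0 \<le> V (Zh s) (Z s)" using Zh_mem[OF s'] Z_mem[of s] s' by (auto intro!: V_nonneg isplx_times simp del: mem_Sigma_iff)
    with 1 have "1 / 2 * (\<beta>\<^sup>2 / 128) \<le> real (card (lvl J s)) / 2 * (V (center J Z s) (Zh s) + V (Zh s) (Z s))"
      using card_lvl_ge[of s] by (intro mult_mono) auto
    moreover have "0 \<le> (\<Sum>j\<in>lvl J s. V (Z (s - 2 ^ j)) (center J Z s))"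
    proof (intro sum_nonneg V_nonneg)
      fix j
      show "Z (s - 2 ^ j) \<in> bal \<times> isplx" by (rule Z_mem) (use s' in auto)
      show "center J Z s \<in> bal \<times> splx" using center_mem[of s] s' isplx_times by auto
    qed
    ultimately show "\<beta>\<^sup>2 / 256 \<le> ret s" unfolding ret_def by simp
  qed
  also have "\<dots> \<le> (\<Sum>s=1..t. ret s)" using ret_nonneg by (intro sum_mono2) auto
  also have "\<dots> \<le> D" using sum_ret_le by (simp add: D_def)
  finally have "real (card ({1..t} - G)) * \<beta>\<^sup>2 \<le> 256 * D" by simp
  moreover have "real (card ({1..t} - G)) = real t - real (card G)"
    using fin card_mono[of "{1..t}" G] by (simp add: card_Diff_subset of_nat_diff)
  moreover have "257 * D \<le> real t * \<beta>\<^sup>2"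
    using assms \<beta>_pos by (simp add: D_def pos_divide_le_eq)
  ultimately have "D \<le> real (card G) * \<beta>\<^sup>2" by (simp add: left_diff_distrib)
  then have "D / \<beta> ^ 3 \<le> real (card G) * \<beta>\<^sup>2 / \<beta> ^ 3"
    using \<beta>_pos by (intro divide_right_mono) auto
  also have "\<dots> = (\<Sum>s\<in>G. 1 / \<beta>)" using \<beta>_pos by (simp add: power2_eq_square power3_eq_cube)
  also have "\<dots> \<le> (\<Sum>s\<in>G. h s)"
  proof (intro sum_mono)
    fix s assume "s \<in> G"
    then show "1 / \<beta> \<le> h s"
      using card_lvl_ge[of s] \<beta>_pos mult_right_mono[of 1 "real (card (lvl J s))" "1 / \<beta>"]
      by (simp add: G_def h_def)
  qed
  also have "\<dots> \<le> H" unfolding H_def using fin h_nonneg by (intro sum_mono2) auto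
  finally show ?thesis by (simp add: D_def)
qed

text \<open>The total regret is at most \<open>D\<close> and the total weight at least
  \<open>D / \<beta> ^ 3\<close>.\<close>

lemma gap_avg_le:
  assumes t: "real t \<ge> 257 * (real J * (1 / 2 + ln (real m))) / \<beta>\<^sup>2" and u: "u \<in> bal \<times> splx"
  shows "avg \<in> bal \<times> splx" and "reg A avg u \<le> \<beta> ^ 3"
proof -
  define D where "D = real J * (1 / 2 + ln (real m))"
  have "0 < 1 / 2 + ln (real m)" using m_pos by (intro add_pos_nonneg) auto
  then have D: "0 < D" unfolding D_def using J_pos by simp
  have H: "D / \<beta> ^ 3 \<le> H" using total_weight_ge[OF t] by (simp add: D_def)
  have "0 < D / \<beta> ^ 3" using D \<beta>_pos by simp
  with H have Hpos: "0 < H" by linarith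
  show "avg \<in> bal \<times> splx" by (rule avg_mem[OF Hpos])
  have "0 \<le> (\<Sum>s=1..t. ret s)" using ret_nonneg by (intro sum_nonneg) auto
  then have "H * reg A avg u \<le> D"
    using regret_le[OF u] reg_avg[OF Hpos, of u] by (simp add: D_def)
  also have "D \<le> H * \<beta> ^ 3" using H \<beta>_pos by (simp add: pos_divide_le_eq)
  finally show "reg A avg u \<le> \<beta> ^ 3" using Hpos by simp
qed

end

section \<open>Query strategies\<close>

text \<open>One strategy has to serve the whole class \<open>C\<close>. With \<open>C\<close> the
  matrices consistent with the answers so far, strategies are built backwards, query by query,
  without being written out as functions of the history.\<close>

definition solvable :: "real \<Rightarrow> nat \<Rightarrow> real mat set \<Rightarrow> bool" where
  "solvable \<epsilon> N C \<longleftrightarrow> (\<exists>S. \<forall>A\<in>C. \<exists>x y k. run S A [] x y k \<and> k \<le> N \<and> eps_solution A \<epsilon> x y)"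

text \<open>A strategy sees the whole history, so a continuation has to be shifted past the answer
  already received.\<close>

lemma run_Cons:
  assumes "run S A h x y k" and "\<And>h. S' (a # h) = S h"
  shows "run S' A (a # h) x y k"
  using assms(1)
proof (induction rule: run.induct)
  case (halt h x y)
  then show ?case using assms(2) by (intro run.halt) simp
next
  case (query h u v x y N)
  then show ?case using assms(2) by (intro run.query[where u = u and v = v]) auto
qed

lemma solvable_mono: "solvable \<epsilon> N C \<Longrightarrow> C' \<subseteq> C \<Longrightarrow> N \<le> N' \<Longrightarrow> solvable \<epsilon> N' C'"
  unfolding solvable_def by (meson order_trans subsetD)

lemma solvable_output:
  assumes "\<And>A. A \<in> C \<Longrightarrow> eps_solution A \<epsilon> x y"
  shows "solvable \<epsilon> N C"
  unfolding solvable_def using assms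
  by (intro exI[of _ "\<lambda>_. Output x y"]) (auto intro!: exI run.halt)

text \<open>A strategy is chosen for every possible answer, and the first answer decides which one
  is followed.\<close>

lemma solvable_query:
  assumes "\<And>A. A \<in> C \<Longrightarrow> u \<in> unit_ball (dim_col A) \<and> v \<in> prob_simplex (dim_row A)"
    and "\<And>a. solvable \<epsilon> N {A \<in> C. matvec A u v = a}"
  shows "solvable \<epsilon> (Suc N) C"
proof -
  obtain S where S: "\<And>a A. A \<in> C \<Longrightarrow> matvec A u v = a \<Longrightarrow>
      \<exists>x y k. run (S a) A [] x y k \<and> k \<le> N \<and> eps_solution A \<epsilon> x y"
    using assms(2) unfolding solvable_def by (simp add: Ball_def) metis
  define S' where "S' h = (case h of [] \<Rightarrow> Query u v | a # h' \<Rightarrow> S a h')" for h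
  have "\<exists>x y k. run S' A [] x y k \<and> k \<le> Suc N \<and> eps_solution A \<epsilon> x y" if A: "A \<in> C" for A
  proof -
    obtain x y k where r: "run (S (matvec A u v)) A [] x y k" "k \<le> N" "eps_solution A \<epsilon> x y"
      using S[OF A refl] by blast
    have "run S' A [matvec A u v] x y k"
      using r(1) by (rule run_Cons) (simp add: S'_def)
    then have "run S' A [] x y (Suc k)"
      using assms(1)[OF A] by (intro run.query[where u = u and v = v]) (auto simp: S'_def)
    then show ?thesis using r by blast
  qed
  then show ?thesis unfolding solvable_def by blast
qed

section \<open>Translation between matrices and coordinate functions\<close>

definition entries :: "real mat \<Rightarrow> nat \<Rightarrow> nat \<Rightarrow> real" where
  "entries A i j = A $$ (i, j)"

context simplex_ball
begin

lemma vec_unit_ball: "vec n x \<in> unit_ball n \<longleftrightarrow> x \<in> bal"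
  by (simp add: unit_ball_def bal_def l2_norm_def scalar_prod_def sqn_def power2_eq_square lessThan_atLeast0)

lemma vec_prob_simplex: "y \<in> splx \<Longrightarrow> vec m y \<in> prob_simplex m"
  by (auto simp: prob_simplex_def splx_def l1_norm_def)

lemma index_unit_ball: "x \<in> unit_ball n \<Longrightarrow> (\<lambda>j. x $ j) \<in> bal"
  by (auto simp: unit_ball_def bal_def l2_norm_def scalar_prod_def sqn_def power2_eq_square lessThan_atLeast0)

lemma index_prob_simplex: "y \<in> prob_simplex m \<Longrightarrow> (\<lambda>i. y $ i) \<in> splx"
  by (auto simp: prob_simplex_def splx_def l1_norm_def)

lemma matvec_eq:
  assumes "A \<in> carrier_mat m n"
  shows "matvec A (vec n x) (vec m y) = (vec n (mt (entries A) y), vec m (mv (entries A) x))"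
  using assms
  by (auto simp: matvec_def mt_def mv_def entries_def scalar_prod_def lessThan_atLeast0 intro!: eq_vecI)

lemma matvec_eqD:
  assumes "A \<in> carrier_mat m n" "A' \<in> carrier_mat m n"
    and "matvec A (vec n x) (vec m y) = matvec A' (vec n x) (vec m y)"
  shows "j < n \<Longrightarrow> mt (entries A) y j = mt (entries A') y j"
    and "i < m \<Longrightarrow> mv (entries A) x i = mv (entries A') x i"
proof -
  have eq: "vec n (mt (entries A) y) = vec n (mt (entries A') y)"
    "vec m (mv (entries A) x) = vec m (mv (entries A') x)"
    using assms(3) by (simp_all add: matvec_eq assms(1,2))
  show "j < n \<Longrightarrow> mt (entries A) y j = mt (entries A') y j"
    using arg_cong[OF eq(1), of "\<lambda>v. v $ j"] by simp
  show "i < m \<Longrightarrow> mv (entries A) x i = mv (entries A') x i"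
    using arg_cong[OF eq(2), of "\<lambda>v. v $ i"] by simp
qed

lemma rows_le_one_entries:
  assumes "A \<in> carrier_mat m n" "\<forall>i<m. l2_norm (row A i) \<le> 1"
  shows "rows_le_one (entries A)"
  unfolding rows_le_one_def
proof (intro allI impI)
  fix i assume i: "i < m"
  have "l2_norm (row A i) = sqrt (sqn (entries A i))"
    using assms(1) i
    by (simp add: l2_norm_def scalar_prod_def sqn_def entries_def power2_eq_square lessThan_atLeast0)
  then have "sqrt (sqn (entries A i)) \<le> 1" using assms(2) i by metis
  then show "sqn (entries A i) \<le> 1" by simp
qed

text \<open>The supremum over \<open>y\<close> and the infimum over \<open>x\<close> decouple, so a
  bound of \<open>reg\<close> at all pairs bounds the gap.\<close>

lemma eps_solutionI:
  assumes A: "A \<in> carrier_mat m n" and z: "z \<in> bal \<times> splx"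
    and reg: "\<And>u. u \<in> bal \<times> splx \<Longrightarrow> reg (entries A) z u \<le> \<epsilon>"
  shows "eps_solution A \<epsilon> (vec n (fst z)) (vec m (snd z))"
proof -
  define f where "f y = y \<bullet> (A *\<^sub>v vec n (fst z))" for y
  define g where "g x = vec m (snd z) \<bullet> (A *\<^sub>v x)" for x
  have fg: "f y - \<epsilon> \<le> g x" if "y \<in> prob_simplex m" "x \<in> unit_ball n" for x y
  proof -
    have d: "dim_vec x = n" "dim_vec y = m" using that by (auto simp: prob_simplex_def unit_ball_def)
    have "f y = (\<Sum>i<m. mv (entries A) (fst z) i * y $ i)"
      using A by (auto simp: f_def scalar_prod_def mv_def entries_def lessThan_atLeast0 mult.commute)
    moreover have "g x = (\<Sum>i<m. snd z i * mv (entries A) (($) x) i)"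
      using A d by (auto simp: g_def scalar_prod_def mv_def entries_def lessThan_atLeast0)
    then have "g x = dot (mt (entries A) (snd z)) (($) x)" by (simp add: sum_mult_mv)
    ultimately have "f y - g x = reg (entries A) z (($) x, ($) y)" by (simp add: reg_def)
    also have "\<dots> \<le> \<epsilon>" using that by (intro reg) (auto intro: index_unit_ball index_prob_simplex)
    finally show ?thesis by simp
  qed
  have ne: "prob_simplex m \<noteq> {}" "unit_ball n \<noteq> {}"
    using vec_prob_simplex vec_unit_ball z by auto
  have "(SUP y\<in>prob_simplex m. f y) - \<epsilon> \<le> (INF x\<in>unit_ball n. g x)"
  proof (rule cINF_greatest[OF ne(2)])
    fix x assume "x \<in> unit_ball n"
    then have "(SUP y\<in>prob_simplex m. f y) \<le> g x + \<epsilon>"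
      using fg by (intro cSUP_least[OF ne(1)]) (simp add: diff_le_eq)
    then show "(SUP y\<in>prob_simplex m. f y) - \<epsilon> \<le> g x" by simp
  qed
  then show ?thesis
    using A z unfolding eps_solution_def duality_gap_def f_def g_def
    by (auto simp: vec_unit_ball vec_prob_simplex)
qed

section \<open>The adaptive loop on classes of indistinguishable matrices\<close>

lemma sum_cong_less: "(\<And>i. i < k \<Longrightarrow> f i = g i) \<Longrightarrow> (\<Sum>i<k. f i) = (\<Sum>i<k. g i)"
  by (rule sum.cong) auto

lemma prox_cong:
  assumes "prox gx gy b z" "\<And>j. j < n \<Longrightarrow> gx j = gx' j" "\<And>i. i < m \<Longrightarrow> gy i = gy' i"
  shows "prox gx' gy' b z"
proof -
  have "lin gx gy = lin gx' gy'"
    unfolding lin_def using assms(2,3) by (intro ext arg_cong2[of _ _ _ _ "(-)"] sum_cong_less) auto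
  then show ?thesis using assms(1) by (simp add: prox_def)
qed

text \<open>An answer given by no matrix of \<open>C\<close> leaves an empty class, which any output
  solves; hence only answers of members \<open>A0\<close> are considered.\<close>

lemma query_rule:
  assumes "C \<subseteq> carrier_mat m n" "x \<in> bal" "y \<in> splx"
    and "\<And>A0. A0 \<in> C \<Longrightarrow> solvable \<epsilon> N {A \<in> C. matvec A (vec n x) (vec m y) = matvec A0 (vec n x) (vec m y)}"
  shows "solvable \<epsilon> (Suc N) C"
proof (rule solvable_query)
  show "vec n x \<in> unit_ball (dim_col A) \<and> vec m y \<in> prob_simplex (dim_row A)" if "A \<in> C" for A
    using assms that by (auto simp: vec_unit_ball vec_prob_simplex)
  show "solvable \<epsilon> N {A \<in> C. matvec A (vec n x) (vec m y) = a}" for a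
  proof (cases "\<exists>A0\<in>C. matvec A0 (vec n x) (vec m y) = a")
    case True
    then show ?thesis using assms(4) by auto
  next
    case False
    then show ?thesis by (intro solvable_output) auto
  qed
qed

text \<open>The loop invariant for one matrix. The data of the run are arguments, so that all
  matrices of a class can share them; each learned direction is heavy at some center up to the
  pending one.\<close>

definition state_ok :: "nat \<Rightarrow> real \<Rightarrow> nat \<Rightarrow> nat \<Rightarrow> (nat \<Rightarrow> (nat \<Rightarrow> real) \<times> (nat \<Rightarrow> real)) \<Rightarrow>
    (nat \<Rightarrow> (nat \<Rightarrow> real) \<times> (nat \<Rightarrow> real)) \<Rightarrow> (nat \<Rightarrow> real) \<Rightarrow> (nat \<Rightarrow> nat \<Rightarrow> real) \<Rightarrow> real mat \<Rightarrow> bool" where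
  "state_ok J \<beta> t K Z Zh \<eta> U A \<longleftrightarrow> A \<in> carrier_mat m n \<and> rows_le_one (entries A) \<and>
     multipoint_run n m J t (entries A) Z Zh \<eta> \<beta> \<and> orthonormal U K \<and>
     (\<forall>k<K. \<exists>s\<in>{1..Suc t}. \<beta>\<^sup>2 / 64 \<le> wsq (entries A) (snd (center J Z s)) (U k))"

lemma center_upd:
  assumes "s \<le> Suc t"
  shows "center J (Z(Suc t := z)) s = center J Z s"
proof (cases "s = 0")
  \<comment> \<open>At \<open>s = 0\<close> truncated subtraction makes every predecessor index
    0.\<close>
  case True
  then show ?thesis by (simp add: center_def)
next
  case False
  have "(Z(Suc t := z)) (s - 2 ^ j) = Z (s - 2 ^ j)" for j :: nat
  proof -
    have "0 < (2::nat) ^ j" by simp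
    then have "s - 2 ^ j < Suc t" using assms False by linarith
    then show ?thesis by simp
  qed
  then show ?thesis by (simp only: center_def)
qed

lemma multipoint_run_extend:
  assumes run: "multipoint_run n m J t A Z Zh \<eta> \<beta>" and t: "Suc t < 2 ^ J"
    and z': "z' \<in> bal \<times> isplx" and z: "z \<in> bal \<times> isplx" and e: "0 \<le> e"
    and full: "e = 1 / \<beta> \<or> dst z (center J Z (Suc t)) = \<beta> / 8"
    and step: "\<And>u. u \<in> bal \<times> splx \<Longrightarrow> e * reg A z u + (V (center J Z (Suc t)) z + V z z') / 2
        \<le> V (center J Z (Suc t)) u - V z' u"
  shows "multipoint_run n m J (Suc t) A (Z(Suc t := z')) (Zh(Suc t := z)) (\<eta>(Suc t := e)) \<beta>"
proof -
  interpret r: multipoint_run n m J t A Z Zh \<eta> \<beta> by (rule run)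
  show ?thesis
  proof
    show "0 < J" "Suc t < 2 ^ J" "0 < \<beta>" by (fact r.J_pos t r.\<beta>_pos)+
    show "(Z(Suc t := z')) 0 = start" using r.Z_0 by simp
    fix s
    show "s \<le> Suc t \<Longrightarrow> (Z(Suc t := z')) s \<in> bal \<times> isplx"
      using r.Z_mem[of s] z' by (cases "s = Suc t") auto
    assume s: "1 \<le> s" "s \<le> Suc t"
    show "(Zh(Suc t := z)) s \<in> bal \<times> isplx"
      using r.Zh_mem[of s] z s by (cases "s = Suc t") auto
    show "0 \<le> (\<eta>(Suc t := e)) s"
      using r.\<eta>_nonneg[of s] e s by (cases "s = Suc t") auto
    show "(\<eta>(Suc t := e)) s = 1 / \<beta> \<or> dst ((Zh(Suc t := z)) s) (center J (Z(Suc t := z')) s) = \<beta> / 8"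
      using r.full_step[of s] full s by (cases "s = Suc t") (auto simp: center_upd)
    fix u assume u: "u \<in> bal \<times> splx"
    show "(\<eta>(Suc t := e)) s * reg A ((Zh(Suc t := z)) s) u
      + (V (center J (Z(Suc t := z')) s) ((Zh(Suc t := z)) s) + V ((Zh(Suc t := z)) s) ((Z(Suc t := z')) s)) / 2
      \<le> V (center J (Z(Suc t := z')) s) u - V ((Z(Suc t := z')) s) u"
      using r.step[of s u] step[OF u] s u by (cases "s = Suc t") (simp_all add: center_upd)
  qed
qed

lemma orthonormal_extend:
  assumes U: "orthonormal U K" and w: "0 < sqn w" and orth: "\<And>k. k < K \<Longrightarrow> dot (U k) w = 0"
  shows "orthonormal (U(K := (\<lambda>j. w j / sqrt (sqn w)))) (Suc K)"
proof -
  let ?w = "\<lambda>j. w j / sqrt (sqn w)"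
  have s: "dot x ?w = dot x w / sqrt (sqn w)" for x
    by (simp add: dot_def sum_divide_distrib)
  have "dot ?w ?w = 1"
    using w by (simp add: s dot_commute[of ?w w]) (simp add: dot_self)
  moreover have "dot (U k) ?w = 0" "dot ?w (U k) = 0" if "k < K" for k
    using orth[OF that] dot_commute[of ?w "U k"] by (simp_all add: s)
  ultimately show ?thesis
    using U unfolding orthonormal_def by (auto simp: less_Suc_eq)
qed

lemma wsq_scale: "wsq A y (\<lambda>j. w j / c) = wsq A y w / c\<^sup>2"
proof -
  have "mv A (\<lambda>j. w j / c) i = mv A w i / c" for i by (simp add: mv_def sum_divide_distrib)
  then show ?thesis by (simp add: wsq_def power_divide sum_divide_distrib)
qed

lemma residual_cong:
  assumes "\<And>j. j < n \<Longrightarrow> x j = y j" "j < n"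
  shows "residual U K x j = residual U K y j"
proof -
  have "dot (U k) x = dot (U k) y" for k
    unfolding dot_def using assms(1) by (intro sum_cong_less) auto
  then show ?thesis using assms by (simp add: residual_def)
qed

text \<open>A round queries the center, the model point and, if a test fails, a new direction. It
  either completes a step or learns that direction and repeats the step with a better model, so
  \<open>(T - t) + (Km - K)\<close> drops at a cost of at most 3 queries. By \<open>agree\<close>
  the matrices of \<open>C\<close> share one model, which makes the queries well defined.\<close>

lemma solvable_loop:
  assumes T: "T < 2 ^ J" "257 * (real J * (1 / 2 + ln (real m))) / \<beta>\<^sup>2 \<le> real T"
    and Km: "64 * (4 + 21 * (real J)\<^sup>2 * (1 / 2 + ln (real m))) / \<beta>\<^sup>2 < real Km + 1"
    and ok: "\<And>A. A \<in> C \<Longrightarrow> state_ok J \<beta> t K Z Zh \<eta> U A"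
    and agree: "\<And>A A' k i. A \<in> C \<Longrightarrow> A' \<in> C \<Longrightarrow> k < K \<Longrightarrow> i < m \<Longrightarrow>
        mv (entries A) (U k) i = mv (entries A') (U k) i"
    and "t \<le> T" and "(T - t) + (Km - K) \<le> N"
  shows "solvable (\<beta> ^ 3) (3 * N) C"
  using ok agree \<open>t \<le> T\<close> \<open>(T - t) + (Km - K) \<le> N\<close>
proof (induction N arbitrary: t K Z Zh \<eta> U C)
  case (Suc N t K Z Zh \<eta> U C)
  \<comment> \<open>This bound keeps \<open>Suc K \<le> Km\<close> after learning, so that the
    truncated difference \<open>Km - K\<close> really drops.\<close>
  have count: "K' \<le> Km" if "state_ok J \<beta> t' K' Z' Zh' \<eta>' U' A" for t' K' Z' Zh' \<eta>' U' A
  proof -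
    have "real K' * \<beta>\<^sup>2 / 64 \<le> 4 + 21 * (real J)\<^sup>2 * (1 / 2 + ln (real m))" and "0 < \<beta>"
      using that multipoint_run.count_heavy_directions[of n m J t' "entries A" Z' Zh' \<eta>' \<beta> U' K']
        multipoint_run.\<beta>_pos unfolding state_ok_def by blast+
    then have "real K' \<le> 64 * (4 + 21 * (real J)\<^sup>2 * (1 / 2 + ln (real m))) / \<beta>\<^sup>2"
      by (simp add: pos_le_divide_eq)
    then show ?thesis using Km by linarith
  qed
  show ?case
  proof (cases "t = T \<or> C = {}")
    case True
    then show ?thesis
    proof
      assume t: "t = T"
      show ?thesis
      proof (rule solvable_output)
        fix A assume "A \<in> C"
        then have A: "state_ok J \<beta> t K Z Zh \<eta> U A" by (rule Suc.prems)
        then interpret r: multipoint_run n m J t "entries A" Z Zh \<eta> \<beta> by (simp add: state_ok_def)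
        have "real t \<ge> 257 * (real J * (1 / 2 + ln (real m))) / \<beta>\<^sup>2" using T t by simp
        note gap = r.gap_avg_le[OF this]
        show "eps_solution A (\<beta> ^ 3) (vec n (fst (multipoint_run.avg J t Zh \<eta>))) (vec m (snd (multipoint_run.avg J t Zh \<eta>)))"
          using A gap isplx_times[OF start_mem] by (intro eps_solutionI) (auto simp: state_ok_def simp del: mem_Sigma_iff)
      qed
    qed (auto intro: solvable_output)
  next
    case False
    then have tT: "t < T" and "C \<noteq> {}" using Suc.prems by auto
    then obtain A00 where A00: "A00 \<in> C" by auto
    have okC: "A \<in> carrier_mat m n" "rows_le_one (entries A)" "multipoint_run n m J t (entries A) Z Zh \<eta> \<beta>"
      "orthonormal U K" "\<forall>k<K. \<exists>s\<in>{1..Suc t}. \<beta>\<^sup>2 / 64 \<le> wsq (entries A) (snd (center J Z s)) (U k)"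
      if "A \<in> C" for A
      using Suc.prems(1)[OF that] by (auto simp: state_ok_def)
    have on: "orthonormal U K" using okC[OF A00] by simp
    have \<beta>: "0 < \<beta>" using okC(3)[OF A00] by (rule multipoint_run.\<beta>_pos)
    define b where "b = center J Z (Suc t)"
    have b: "b \<in> bal \<times> isplx"
      unfolding b_def using multipoint_run.center_mem[OF okC(3)[OF A00], of "Suc t"] by simp
    have "solvable (\<beta> ^ 3) (Suc (Suc (Suc (3 * N)))) C"
    proof (rule query_rule[of _ "fst b" "snd b"])
      show "C \<subseteq> carrier_mat m n" "fst b \<in> bal" "snd b \<in> splx" using okC isplx_times[OF b] by auto
      fix A0 assume A0: "A0 \<in> C"
      define C1 where "C1 = {A \<in> C. matvec A (vec n (fst b)) (vec m (snd b)) = matvec A0 (vec n (fst b)) (vec m (snd b))}"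
      have C1: "A \<in> C" "\<And>j. j < n \<Longrightarrow> mt (entries A) (snd b) j = mt (entries A0) (snd b) j"
        "\<And>i. i < m \<Longrightarrow> mv (entries A) (fst b) i = mv (entries A0) (fst b) i" if "A \<in> C1" for A
        using matvec_eqD[OF okC(1) okC(1), of A A0 "fst b" "snd b"] that A0 by (auto simp: C1_def)
      \<comment> \<open>The model is read off a representative \<open>A0\<close>; every matrix of
        \<open>C1\<close> gives the same values on the relevant indices.\<close>
      define M p s where "M = learned (entries A0) U K"
        and "p j = mt (entries A0) (snd b) j - mt M (snd b) j"
        and "s i = mv (entries A0) (fst b) i - mv M (fst b) i" for i j
      have M: "learned (entries A) U K i j = M i j" if "A \<in> C" "i < m" for A i j
        unfolding M_def learned_def using Suc.prems(2)[OF that(1) A0 _ that(2)] by (intro sum_cong_less) auto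
      have mvM: "mv (learned (entries A) U K) x i = mv M x i" if "A \<in> C" "i < m" for A x i
        unfolding mv_def using M that by simp
      have mtM: "mt (learned (entries A) U K) y j = mt M y j" if "A \<in> C" for A y j
        unfolding mt_def using M that by (intro sum_cong_less) auto
      obtain e z where e: "0 \<le> e" "e \<le> 1 / \<beta>" and ms: "model_step M p s b e z" and near: "dst z b \<le> \<beta> / 8"
        and full: "e = 1 / \<beta> \<or> dst z b = \<beta> / 8"
        using capped_model_step[OF b, of "\<beta> / 8" "1 / \<beta>" M p s] \<beta> by auto
      have z: "z \<in> bal \<times> isplx" using ms by (simp add: model_step_def prox_def)
      have "solvable (\<beta> ^ 3) (Suc (Suc (3 * N))) C1"
      proof (rule query_rule[of _ "fst z" "snd z"])
        show "C1 \<subseteq> carrier_mat m n" "fst z \<in> bal" "snd z \<in> splx" using okC C1 isplx_times[OF z] by auto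
        fix A1 assume A1: "A1 \<in> C1"
        define C2 where "C2 = {A \<in> C1. matvec A (vec n (fst z)) (vec m (snd z)) = matvec A1 (vec n (fst z)) (vec m (snd z))}"
        have A1C: "A1 \<in> C" using A1 C1 by blast
        have C2: "A \<in> C" "A \<in> C1" "\<And>j. j < n \<Longrightarrow> mt (entries A) (snd z) j = mt (entries A1) (snd z) j"
          "\<And>i. i < m \<Longrightarrow> mv (entries A) (fst z) i = mv (entries A1) (fst z) i"
          "\<And>j. j < n \<Longrightarrow> mt (entries A) (snd b) j = mt (entries A1) (snd b) j"
          "\<And>i. i < m \<Longrightarrow> mv (entries A) (fst b) i = mv (entries A1) (fst b) i" if "A \<in> C2" for A
        proof -
          show "A \<in> C1" "A \<in> C" using that C1 by (auto simp: C2_def)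
          then show "\<And>j. j < n \<Longrightarrow> mt (entries A) (snd z) j = mt (entries A1) (snd z) j"
            "\<And>i. i < m \<Longrightarrow> mv (entries A) (fst z) i = mv (entries A1) (fst z) i"
            using matvec_eqD[OF okC(1) okC(1), of A A1 "fst z" "snd z"] that A1C by (auto simp: C2_def)
          show "\<And>j. j < n \<Longrightarrow> mt (entries A) (snd b) j = mt (entries A1) (snd b) j"
            "\<And>i. i < m \<Longrightarrow> mv (entries A) (fst b) i = mv (entries A1) (fst b) i"
            using C1[OF \<open>A \<in> C1\<close>] C1[OF A1] by auto
        qed
        \<comment> \<open>The tests are evaluated with the representative \<open>A1\<close>; the
          facts below show that their outcome is the same on all of \<open>C2\<close>.\<close>
        define u where "u = residual U K (\<lambda>j. fst z j - fst b j)"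
        define v where "v A = residual U K (\<lambda>j. mt (entries A) (snd z) j - mt (entries A) (snd b) j)" for A
        have v_eq: "v A j = v A1 j" if "A \<in> C2" "j < n" for A j
          unfolding v_def using C2(3,5)[OF that(1)] that(2) by (intro residual_cong) auto
        have sqn_v: "sqn (v A) = sqn (v A1)" if "A \<in> C2" for A
          unfolding sqn_def using v_eq[OF that] by (intro sum_cong_less) auto
        have mv_v: "mv (entries A) (v A) = mv (entries A) (v A1)" if "A \<in> C2" for A
          unfolding mv_def using v_eq[OF that] by (intro ext sum_cong_less) auto
        have wsq_u: "wsq (entries A) (snd z) u = wsq (entries A1) (snd z) u" if "A \<in> C2" for A
          unfolding wsq_def u_def mv_residual mv_diff
          using C2(1,4,6)[OF that] mvM A1C by (intro sum_cong_less) simp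
        have ms': "model_step (learned (entries A) U K)
            (\<lambda>j. mt (entries A) (snd b) j - mt (learned (entries A) U K) (snd b) j)
            (\<lambda>i. mv (entries A) (fst b) i - mv (learned (entries A) U K) (fst b) i) b e z" if "A \<in> C2" for A
        proof -
          have "mt (learned (entries A) U K) y j = mt M y j" for y j using mtM C2(1)[OF that] by blast
          then show ?thesis
            using ms C1(2,3)[OF C2(2)[OF that]] mvM[OF C2(1)[OF that]]
            unfolding model_step_def mt_def[symmetric] mv_def[symmetric] p_def s_def
            by (elim prox_cong) auto
        qed
        \<comment> \<open>The failed round: the normalized residual becomes the next learned
          direction, and the recorded run stays as it is.\<close>
        have learn: "solvable (\<beta> ^ 3) (Suc (3 * N)) C2"
          if w: "0 < sqn w" and orth: "\<And>k. k < K \<Longrightarrow> dot (U k) w = 0"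
            and heavy: "\<And>A. A \<in> C2 \<Longrightarrow> \<beta>\<^sup>2 / 64 * sqn w \<le> wsq (entries A) (snd b) w" for w
        proof (rule query_rule[of _ "\<lambda>j. w j / sqrt (sqn w)" "snd b"])
          let ?w = "\<lambda>j. w j / sqrt (sqn w)"
          let ?U = "U(K := ?w)"
          have on': "orthonormal ?U (Suc K)" by (rule orthonormal_extend[OF on w orth])
          then have "dot ?w ?w = 1" unfolding orthonormal_def by (metis fun_upd_same lessI)
          then show "?w \<in> bal" by (simp add: bal_def dot_self)
          show "C2 \<subseteq> carrier_mat m n" "snd b \<in> splx" using okC C2 isplx_times[OF b] by auto
          fix A2 assume A2: "A2 \<in> C2"
          define C3 where "C3 = {A \<in> C2. matvec A (vec n ?w) (vec m (snd b)) = matvec A2 (vec n ?w) (vec m (snd b))}"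
          have ok3: "state_ok J \<beta> t (Suc K) Z Zh \<eta> ?U A" if "A \<in> C3" for A
          proof -
            have A: "A \<in> C2" "A \<in> C" using that C2(1) by (auto simp: C3_def)
            have "\<beta>\<^sup>2 / 64 \<le> wsq (entries A) (snd b) ?w"
              using heavy[OF A(1)] w by (simp add: wsq_scale pos_le_divide_eq)
            then have "\<exists>s\<in>{1..Suc t}. \<beta>\<^sup>2 / 64 \<le> wsq (entries A) (snd (center J Z s)) (?U k)" if "k < Suc K" for k
              using okC(5)[OF A(2)] that unfolding b_def by (cases "k = K") auto
            then show ?thesis using okC(1-3)[OF A(2)] on' by (simp add: state_ok_def)
          qed
          have "solvable (\<beta> ^ 3) (3 * N) C3"
          proof (rule Suc.IH[OF ok3])
            have "A2 \<in> C3" using A2 by (simp add: C3_def)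
            then have "Suc K \<le> Km" using count ok3 by blast
            then show "T - t + (Km - Suc K) \<le> N" using Suc.prems(4) by linarith
            show "t \<le> T" using tT by simp
            fix A A' k i assume AA: "A \<in> C3" "A' \<in> C3" and k: "k < Suc K" and i: "i < m"
            have AC: "A \<in> C" "A' \<in> C" using AA C2(1) by (auto simp: C3_def)
            have "mv (entries A) ?w i = mv (entries A') ?w i"
              using AA by (intro matvec_eqD(2)[OF okC(1)[OF AC(1)] okC(1)[OF AC(2)] _ i, of _ "snd b"]) (simp add: C3_def)
            then show "mv (entries A) (?U k) i = mv (entries A') (?U k) i"
              using Suc.prems(2)[OF AC _ i, of k] k by (cases "k = K") auto
          qed
          then show "solvable (\<beta> ^ 3) (3 * N) {A \<in> C2. matvec A (vec n ?w) (vec m (snd b)) = matvec A2 (vec n ?w) (vec m (snd b))}"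
            by (simp add: C3_def)
        qed
        have "solvable (\<beta> ^ 3) (Suc (3 * N)) C2"
        proof (cases "4 * e\<^sup>2 * sqn (v A1) \<le> he (snd z) (snd b)")
          case False
          show ?thesis
          proof (rule learn[of "v A1"])
            show "0 < sqn (v A1)"
              by (rule heavy_direction_y(1)[OF okC(2)[OF A1C] on b z \<beta> e near u_def v_def[of A1] False])
            show "dot (U k) (v A1) = 0" if "k < K" for k
              unfolding v_def by (rule residual_orthogonal[OF on that])
            show "\<beta>\<^sup>2 / 64 * sqn (v A1) \<le> wsq (entries A) (snd b) (v A1)" if "A \<in> C2" for A
              using heavy_direction_y(2)[OF okC(2)[OF C2(1)[OF that]] on b z \<beta> e near u_def v_def[of A]]
                False sqn_v[OF that] mv_v[OF that] by (simp add: wsq_def)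
          qed
        next
          case crit_y: True
          show ?thesis
          proof (cases "16 * e\<^sup>2 * wsq (entries A1) (snd z) u \<le> sqn (\<lambda>j. fst z j - fst b j)")
            case False
            show ?thesis
            proof (rule learn[of u])
              show "0 < sqn u"
                by (rule heavy_direction_x(1)[OF okC(2)[OF A1C] on b z \<beta> e near u_def v_def[of A1] False])
              show "dot (U k) u = 0" if "k < K" for k
                unfolding u_def by (rule residual_orthogonal[OF on that])
              show "\<beta>\<^sup>2 / 64 * sqn u \<le> wsq (entries A) (snd b) u" if "A \<in> C2" for A
                using heavy_direction_x(2)[OF okC(2)[OF C2(1)[OF that]] on b z \<beta> e near u_def v_def[of A]]
                  False wsq_u[OF that] by simp
            qed
          next
            case crit_x: True
            \<comment> \<open>With zero bilinear part \<open>prox_exists\<close> yields the explicit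
              correction step with the gradient at \<open>z\<close>.\<close>
            obtain z' where z': "prox (\<lambda>j. e * mt (entries A1) (snd z) j) (\<lambda>i. e * mv (entries A1) (fst z) i) b z'"
              using prox_exists[OF b, of "\<lambda>_ _. 0" "\<lambda>j. e * mt (entries A1) (snd z) j" "\<lambda>i. e * mv (entries A1) (fst z) i"] by auto
            have z'm: "z' \<in> bal \<times> isplx" using z' by (simp add: prox_def)
            have "solvable (\<beta> ^ 3) (3 * N) C2"
            proof (rule Suc.IH)
              show "Suc t \<le> T" "T - Suc t + (Km - K) \<le> N" using tT Suc.prems(4) by linarith+
              show "mv (entries A) (U k) i = mv (entries A') (U k) i"
                if "A \<in> C2" "A' \<in> C2" "k < K" "i < m" for A A' k i
                using Suc.prems(2) C2(1) that by blast
              fix A assume A: "A \<in> C2"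
              have "e * reg (entries A) z w + (V b z + V z z') / 2 \<le> V b w - V z' w" if w: "w \<in> bal \<times> splx" for w
              proof (rule extragradient[OF okC(2)[OF C2(1)[OF A]] on b z \<beta> e near u_def v_def[of A] ms'[OF A] _ _ _ w])
                show "prox (\<lambda>j. e * mt (entries A) (snd z) j) (\<lambda>i. e * mv (entries A) (fst z) i) b z'"
                  using z' C2(3,4)[OF A] by (elim prox_cong) auto
                show "4 * e\<^sup>2 * sqn (v A) \<le> he (snd z) (snd b)" using crit_y sqn_v[OF A] by simp
                show "16 * e\<^sup>2 * wsq (entries A) (snd z) u \<le> sqn (\<lambda>j. fst z j - fst b j)"
                  using crit_x wsq_u[OF A] by simp
              qed
              then have "multipoint_run n m J (Suc t) (entries A) (Z(Suc t := z')) (Zh(Suc t := z)) (\<eta>(Suc t := e)) \<beta>"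
                using okC(3)[OF C2(1)[OF A]] tT T(1) z'm z e(1) full
                by (intro multipoint_run_extend) (auto simp: b_def)
              moreover have "\<exists>s\<in>{1..Suc (Suc t)}. \<beta>\<^sup>2 / 64 \<le> wsq (entries A) (snd (center J (Z(Suc t := z')) s)) (U k)"
                if k: "k < K" for k
              proof -
                obtain s where "s \<in> {1..Suc t}" "\<beta>\<^sup>2 / 64 \<le> wsq (entries A) (snd (center J Z s)) (U k)"
                  using okC(5)[OF C2(1)[OF A]] k by blast
                then show ?thesis by (intro bexI[of _ s]) (auto simp: center_upd)
              qed
              ultimately show "state_ok J \<beta> (Suc t) K (Z(Suc t := z')) (Zh(Suc t := z)) (\<eta>(Suc t := e)) U A"
                using okC(1,2,4)[OF C2(1)[OF A]] by (simp add: state_ok_def)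
            qed
            then show ?thesis by (rule solvable_mono) auto
          qed
        qed
        then show "solvable (\<beta> ^ 3) (Suc (3 * N))
            {A \<in> C1. matvec A (vec n (fst z)) (vec m (snd z)) = matvec A1 (vec n (fst z)) (vec m (snd z))}"
          by (simp add: C2_def)
      qed
      then show "solvable (\<beta> ^ 3) (Suc (Suc (3 * N)))
          {A \<in> C. matvec A (vec n (fst b)) (vec m (snd b)) = matvec A0 (vec n (fst b)) (vec m (snd b))}"
        by (simp add: C1_def)
    qed
    then show ?thesis by (simp add: numeral_3_eq_3)
  qed
next
  case (0 t K Z Zh \<eta> U C)
  then have t: "t = T" by simp
  show ?case
  proof (rule solvable_output)
    fix A assume "A \<in> C"
    then have A: "state_ok J \<beta> t K Z Zh \<eta> U A" by (rule 0)
    then interpret r: multipoint_run n m J t "entries A" Z Zh \<eta> \<beta> by (simp add: state_ok_def)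
    have "real t \<ge> 257 * (real J * (1 / 2 + ln (real m))) / \<beta>\<^sup>2" using T t by simp
    note gap = r.gap_avg_le[OF this]
    show "eps_solution A (\<beta> ^ 3) (vec n (fst (multipoint_run.avg J t Zh \<eta>))) (vec m (snd (multipoint_run.avg J t Zh \<eta>)))"
      using A gap isplx_times[OF start_mem] by (intro eps_solutionI) (auto simp: state_ok_def simp del: mem_Sigma_iff)
  qed
qed

section \<open>Choice of parameters and the query bound\<close>

definition inst :: "real mat set" where
  "inst = {A \<in> carrier_mat m n. \<forall>i<m. l2_norm (row A i) \<le> 1}"

text \<open>The ball part of \<open>start\<close> is 0 and all entries of \<open>A x\<close> have
  modulus at most 1 on the ball, so its gap is at most 1.\<close>

lemma solvable_trivial:
  assumes "1 \<le> \<epsilon>"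
  shows "solvable \<epsilon> 0 inst"
proof (rule solvable_output)
  fix A assume "A \<in> inst"
  then have A: "A \<in> carrier_mat m n" and rows: "rows_le_one (entries A)"
    using rows_le_one_entries by (auto simp: inst_def)
  show "eps_solution A \<epsilon> (vec n (fst start)) (vec m (snd start))"
  proof (rule eps_solutionI[OF A isplx_times[OF start_mem]])
    fix u assume u: "u \<in> bal \<times> splx"
    have "- mv (entries A) (fst u) i \<le> 1" if "i < m" for i
    proof -
      have "sqrt (sqn (fst u)) \<le> 1" using u by (auto simp: bal_def)
      then show ?thesis using abs_mv_le[OF rows that, of "fst u"] by linarith
    qed
    then have "(\<Sum>i<m. snd start i * - mv (entries A) (fst u) i) \<le> (\<Sum>i<m. snd start i * 1)"
      by (intro sum_mono mult_left_mono) (auto simp: start_def)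
    also have "\<dots> = 1" using start_mem by (auto simp: isplx_def mem_Times_iff)
    finally have "- dot (mt (entries A) (snd start)) (fst u) \<le> 1"
      by (simp add: sum_negf flip: sum_mult_mv)
    moreover have "mv (entries A) (fst start) i = 0" for i by (simp add: mv_def start_def)
    ultimately show "reg (entries A) start u \<le> \<epsilon>" using assms by (simp add: reg_def)
  qed
qed

lemma solvable_main:
  assumes "0 < \<beta>" "0 < J" "T < 2 ^ J" "257 * (real J * (1 / 2 + ln (real m))) / \<beta>\<^sup>2 \<le> real T"
    and "64 * (4 + 21 * (real J)\<^sup>2 * (1 / 2 + ln (real m))) / \<beta>\<^sup>2 < real Km + 1"
  shows "solvable (\<beta> ^ 3) (3 * (T + Km)) inst"
proof (rule solvable_loop[where t = 0 and K = 0 and Z = "\<lambda>_. start"])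
  fix A assume "A \<in> inst"
  then have A: "A \<in> carrier_mat m n" and rows: "rows_le_one (entries A)"
    using rows_le_one_entries by (auto simp: inst_def)
  have "multipoint_run n m J 0 (entries A) (\<lambda>_. start) Zh \<eta> \<beta>" for Zh \<eta>
    by unfold_locales (use assms start_mem in auto)
  then show "state_ok J \<beta> 0 0 (\<lambda>_. start) Zh \<eta> U A" for Zh \<eta> U
    using A rows by (simp add: state_ok_def orthonormal_def)
qed (use assms in auto)

lemma solvable_bounded:
  assumes "0 < n" and \<epsilon>: "0 < \<epsilon>" "\<epsilon> < 1"
  shows "\<exists>N. solvable \<epsilon> N inst \<and>
    real N \<le> 4000000 * ln (2 + real n + real m + 1 / \<epsilon>) ^ 3 * \<epsilon> powr (- 2 / 3)"
proof -
  define X L \<beta> E D where "X = 2 + real n + real m + 1 / \<epsilon>" and "L = ln X"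
    and "\<beta> = \<epsilon> powr (1 / 3)" and "E = \<epsilon> powr (- 2 / 3)" and "D = 1 / 2 + ln (real m)"
  have inv: "1 < 1 / \<epsilon>" using \<epsilon> by simp
  have X: "4 \<le> X" "1 / \<epsilon> \<le> X" "real m \<le> X"
    using inv assms(1) m_pos by (simp_all add: X_def)
  have "exp 1 \<le> X" using X(1) exp_le by linarith
  then have L1: "1 \<le> L" unfolding L_def using X by (subst ln_ge_iff) auto
  have LX: "L \<le> X" unfolding L_def using X ln_less_self[of X] by linarith
  have D: "0 < D" "D \<le> 2 * L"
  proof -
    have "0 \<le> ln (real m)" using m_pos by simp
    moreover have "ln (real m) \<le> L" unfolding L_def using X m_pos by simp
    ultimately show "0 < D" "D \<le> 2 * L" using L1 by (auto simp: D_def)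
  qed
  have \<beta>: "0 < \<beta>" "\<beta> ^ 3 = \<epsilon>"
    using \<epsilon> by (auto simp: \<beta>_def powr_power)
  have E\<beta>: "c / \<beta>\<^sup>2 = c * E" for c
    using \<epsilon> by (simp add: \<beta>_def E_def powr_power powr_minus_divide)
  have E1: "1 \<le> E"
    using \<epsilon> powr_mono'[of "- 2 / 3" 0 \<epsilon>] by (simp add: E_def)
  have EX: "E \<le> X"
  proof -
    have "E \<le> \<epsilon> powr (- 1)" unfolding E_def using \<epsilon> by (intro powr_mono') auto
    then show ?thesis using X(2) \<epsilon> by (simp add: powr_minus_divide)
  qed
  \<comment> \<open>With \<open>ln 2 \<ge> 1 / 2\<close>, these levels give
    \<open>2 ^ J \<ge> exp (10 * L) = X ^ 10\<close>, above the bound of order \<open>X ^ 3\<close>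
    for \<open>T\<close>.\<close>
  define J where "J = nat \<lceil>20 * L\<rceil>"
  have J: "20 * L \<le> real J" "real J \<le> 21 * L" "0 < J"
    using L1 unfolding J_def by (linarith | simp)+
  define T where "T = nat \<lceil>257 * (real J * D) * E\<rceil>"
  \<comment> \<open>Rounding down suffices, since the bound is compared with
    \<open>Km + 1\<close>.\<close>
  define Km where "Km = nat \<lfloor>64 * (4 + 21 * (real J)\<^sup>2 * D) * E\<rfloor>"
  have JD: "0 \<le> real J * D" "real J * D \<le> 42 * L\<^sup>2"
  proof -
    show "0 \<le> real J * D" using D by simp
    have "real J * D \<le> (21 * L) * (2 * L)" using J D L1 by (intro mult_mono) auto
    then show "real J * D \<le> 42 * L\<^sup>2" by (simp add: power2_eq_square)
  qed
  have L2: "1 \<le> L\<^sup>2" "L\<^sup>2 \<le> L ^ 3" "1 \<le> L ^ 3"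
    using L1 by (auto intro: power_increasing)
  have T1: "257 * (real J * D) * E \<le> real T" unfolding T_def by linarith
  have T2: "real T \<le> 10795 * L\<^sup>2 * E"
  proof -
    have "0 \<le> 257 * (real J * D) * E" using D(1) E1 by (intro mult_nonneg_nonneg) auto
    then have "real T \<le> 257 * (real J * D) * E + 1" unfolding T_def by linarith
    \<comment> \<open>The constant is \<open>10795 = 257 * 42 + 1\<close>, the 1 coming from
      rounding up.\<close>
    also have "\<dots> \<le> 257 * (42 * L\<^sup>2) * E + L\<^sup>2 * E"
    proof (rule add_mono)
      show "257 * (real J * D) * E \<le> 257 * (42 * L\<^sup>2) * E"
        using JD(2) E1 by (intro mult_right_mono mult_left_mono) auto
      show "1 \<le> L\<^sup>2 * E" using L2(1) E1 mult_mono[of 1 "L\<^sup>2" 1 E] by simp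
    qed
    also have "\<dots> = 10795 * L\<^sup>2 * E" by simp
    finally show ?thesis .
  qed
  have K1: "64 * (4 + 21 * (real J)\<^sup>2 * D) * E < real Km + 1" unfolding Km_def by linarith
  have K2: "real Km \<le> 1185664 * L ^ 3 * E"
  proof -
    have "0 \<le> 64 * (4 + 21 * (real J)\<^sup>2 * D) * E" using D E1 by (intro mult_nonneg_nonneg add_nonneg_nonneg) auto
    then have "real Km \<le> 64 * (4 + 21 * (real J)\<^sup>2 * D) * E" unfolding Km_def by linarith
    \<comment> \<open>Here \<open>18526 = 4 + 21 * 882\<close>, with
      \<open>882 = 21\<^sup>2 * 2\<close> from the bounds on \<open>J\<close> and
      \<open>D\<close>.\<close>
    also have "\<dots> \<le> 64 * (18526 * L ^ 3) * E"
    proof (intro mult_right_mono mult_left_mono)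
      have "(real J)\<^sup>2 * D \<le> (21 * L)\<^sup>2 * (2 * L)"
        using J D L1 by (intro mult_mono power_mono) auto
      also have "\<dots> = 882 * L ^ 3" by (simp add: power2_eq_square power3_eq_cube)
      finally show "4 + 21 * (real J)\<^sup>2 * D \<le> 18526 * L ^ 3" using L2 by simp
    qed (use E1 in auto)
    finally show ?thesis by simp
  qed
  have "T < 2 ^ J"
  proof -
    have "L\<^sup>2 * E \<le> X\<^sup>2 * X" using LX L1 EX X E1 by (intro mult_mono power_mono) auto
    then have "real T \<le> 10795 * X ^ 3" using T2 by (simp add: power2_eq_square power3_eq_cube)
    also have "\<dots> < 4 ^ 7 * X ^ 3" using X by simp
    also have "\<dots> \<le> X ^ 7 * X ^ 3" using X by (intro mult_right_mono power_mono) auto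
    also have "\<dots> = X ^ 10" by (simp flip: power_add)
    also have "X = exp L" using X by (simp add: L_def)
    also have "exp L ^ 10 = exp (10 * L)" by (simp flip: exp_of_nat_mult)
    also have "\<dots> \<le> exp (real J * ln 2)"
    proof -
      have "exp (1 / 2) \<le> (2 :: real)"
        using exp_le power2_le_imp_le[of "exp (1 / 2)" "2 :: real"] by (simp flip: exp_double)
      then have "1 / 2 \<le> ln (2 :: real)" by (intro ln_ge_iff[THEN iffD2]) auto
      then have "20 * L * (1 / 2) \<le> real J * ln 2" using J L1 by (intro mult_mono) auto
      then show ?thesis by simp
    qed
    also have "\<dots> = 2 ^ J" by (simp add: exp_of_nat_mult)
    finally show ?thesis by (simp flip: of_nat_less_iff)
  qed
  then have "solvable (\<beta> ^ 3) (3 * (T + Km)) inst"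
    using \<beta> J T1 K1 by (intro solvable_main) (auto simp: E\<beta> D_def)
  \<comment> \<open>The constant covers \<open>3 * (10795 + 1185664) = 3589377\<close>.\<close>
  moreover have "real (3 * (T + Km)) \<le> 4000000 * L ^ 3 * E"
  proof -
    have "L\<^sup>2 * E \<le> L ^ 3 * E" using L2 E1 by (intro mult_right_mono) auto
    moreover have "0 \<le> L ^ 3 * E" using L1 E1 by (intro mult_nonneg_nonneg zero_le_power) auto
    ultimately show ?thesis using T2 K2 unfolding mult.assoc by simp
  qed
  ultimately show ?thesis unfolding \<beta>(2) L_def X_def E_def by blast
qed

end

theorem theorem1p2:
  "\<exists>(alg :: matvec_algorithm) (C :: real) (p :: nat).
     \<forall>(n :: nat) (m :: nat) (\<epsilon> :: real) (A :: real mat).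
       n > 0 \<and> m > 0 \<and> \<epsilon> > 0 \<and> A \<in> carrier_mat m n \<and> (\<forall>i<m. l2_norm (row A i) \<le> 1) \<longrightarrow>
       (\<exists>x y N. run (alg n m \<epsilon>) A [] x y N \<and> eps_solution A \<epsilon> x y \<and>
          real N \<le> C * ln (2 + real n + real m + 1 / \<epsilon>) ^ p * \<epsilon> powr (- 2 / 3))"
proof -
  \<comment> \<open>The strategy may depend on \<open>n\<close>, \<open>m\<close> and
    \<open>\<epsilon>\<close> but not on \<open>A\<close>, so \<open>A\<close> is quantified inside
    and the strategy is picked by choice for each triple.\<close>
  define good where "good n m \<epsilon> S \<longleftrightarrow> (\<forall>A \<in> simplex_ball.inst n m. \<exists>x y N. run S A [] x y N \<and> eps_solution A \<epsilon> x y \<and>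
      real N \<le> 4000000 * ln (2 + real n + real m + 1 / \<epsilon>) ^ 3 * \<epsilon> powr (- 2 / 3))"
    for n m \<epsilon> S
  have "\<exists>S. good n m \<epsilon> S" if "n > 0" "m > 0" "\<epsilon> > 0" for n m \<epsilon>
  proof -
    interpret simplex_ball n m by unfold_locales (fact that(2))
    have "\<exists>N. solvable \<epsilon> N inst \<and>
        real N \<le> 4000000 * ln (2 + real n + real m + 1 / \<epsilon>) ^ 3 * \<epsilon> powr (- 2 / 3)"
    proof (cases "\<epsilon> < 1")
      case True
      then show ?thesis using solvable_bounded that by blast
    next
      case False
      have "0 \<le> ln (2 + real n + real m + 1 / \<epsilon>)" using that by (intro ln_ge_zero) simp
      then have "real 0 \<le> 4000000 * ln (2 + real n + real m + 1 / \<epsilon>) ^ 3 * \<epsilon> powr (- 2 / 3)" by simp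
      then show ?thesis using solvable_trivial[of \<epsilon>] False by fastforce
    qed
    then obtain N S where S: "\<forall>A\<in>inst. \<exists>x y k. run S A [] x y k \<and> k \<le> N \<and> eps_solution A \<epsilon> x y"
      and N: "real N \<le> 4000000 * ln (2 + real n + real m + 1 / \<epsilon>) ^ 3 * \<epsilon> powr (- 2 / 3)"
      unfolding solvable_def by blast
    have "good n m \<epsilon> S"
      unfolding good_def
    proof
      fix A assume "A \<in> inst"
      then obtain x y k where "run S A [] x y k" "k \<le> N" "eps_solution A \<epsilon> x y" using S by blast
      moreover from \<open>k \<le> N\<close> have "real k \<le> real N" by simp
      ultimately show "\<exists>x y N. run S A [] x y N \<and> eps_solution A \<epsilon> x y \<and>
          real N \<le> 4000000 * ln (2 + real n + real m + 1 / \<epsilon>) ^ 3 * \<epsilon> powr (- 2 / 3)"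
        using N order_trans by blast
    qed
    then show ?thesis by blast
  qed
  then have "good n m \<epsilon> (SOME S. good n m \<epsilon> S)" if "n > 0" "m > 0" "\<epsilon> > 0" for n m \<epsilon>
    using someI_ex[of "good n m \<epsilon>"] that by simp
  then show ?thesis
    by (intro exI[of _ "\<lambda>n m \<epsilon>. SOME S. good n m \<epsilon> S"] exI[of _ 4000000] exI[of _ 3])
      (auto simp: good_def simplex_ball.inst_def simplex_ball_def)
qed

end
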